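(* Let $(A,\circ)$ be a finite-dimensional Novikov algebra over $\mathbf{k}$ with a bilinear form $\omega(\cdot,\cdot)$, $(B=\oplus_{i\in\mathbb{Z}}B_i,\diamond,(\cdot,\cdot))$ a quadratic $\mathbb{Z}$-graded right Novikov algebra, and $L=A\otimes B$ the induced Lie algebra. Define a bilinear form $(\cdot,\cdot)_L$ on $L$ by $$(a_1\otimes b_1,a_2\otimes b_2)_L=\omega(a_1,a_2)(b_1,b_2)\qquad\text{for all }a_1,a_2\in A,\ b_1,b_2\in B.$$ If $(A,\circ,\omega(\cdot,\cdot))$ is a quasi-Frobenius Novikov algebra, then $(L,(\cdot,\cdot)_L)$ is a quasi-Frobenius $\mathbb{Z}$-graded Lie algebra. Furthermore, if $B=\mathbf{k}[t,t^{-1}]$ with $B_i=\mathbf{k}t^{i+1}$, $t^i\diamond t^j=it^{i+j-1}$ and $(t^i,t^j)=\delta_{i+j+1,0}$, then $(L,(\cdot,\cdot)_L)$ is a quasi-Frobenius $\mathbb{Z}$-graded Lie algebra if and only if $(A,\circ,\omega(\cdot,\cdot))$ is a quasi-Frobenius Novikov algebra.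
   Context: $\mathbf{k}$ is a field of characteristic zero. A Novikov algebra $(A,\circ)$: $(a\circ b)\circ c-a\circ(b\circ c)=(b\circ a)\circ c-b\circ(a\circ c)$ and $(a\circ b)\circ c=(a\circ c)\circ b$; $a\star b:=a\circ b+b\circ a$. A quasi-Frobenius Novikov algebra $(A,\circ,\omega)$ is a Novikov algebra with a skewsymmetric nondegenerate bilinear form $\omega$ such that $\omega(a\circ b,c)-\omega(a\star c,b)+\omega(c\circ b,a)=0$ for all $a,b,c\in A$. A right Novikov algebra $(B,\diamond)$: $(a\diamond b)\diamond c-a\diamond(b\diamond c)=(a\diamond c)\diamond b-a\diamond(c\diamond b)$ and $a\diamond(b\diamond c)=b\diamond(a\diamond c)$. A bilinear form on a $\mathbb{Z}$-graded space $\oplus B_i$ is graded if there is $m\in\mathbb{Z}$ with $(B_i,B_j)=0$ whenever $i+j+m\neq0$. Quadratic $\mathbb{Z}$-graded right Novikov algebra: $B=\oplus_{i\in\mathbb{Z}}B_i$ right Novikov, each $B_i$ finite-dimensional, $B_i\diamond B_j\subset B_{i+j}$, with a symmetric nondegenerate graded bilinear form satisfying $(a\diamond b,c)=-(a,b\diamond c+c\diamond b)$. Induced Lie algebra: $[a_1\otimes b_1,a_2\otimes b_2]=a_1\circ a_2\otimes b_1\diamond b_2-a_2\circ a_1\otimes b_2\diamond b_1$, graded by $L_i=A\otimes B_i$. A $\mathbb{Z}$-graded Lie algebra is $L=\oplus_{i\in\mathbb{Z}}L_i$ with each $L_i$ finite-dimensional and $[L_i,L_j]\subset L_{i+j}$.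 It is quasi-Frobenius with respect to $(\cdot,\cdot)_L$ if $(\cdot,\cdot)_L$ is a skewsymmetric nondegenerate graded bilinear form with $([a,b],c)_L+([c,a],b)_L+([b,c],a)_L=0$ for all $a,b,c\in L$. *)

theory Defs
  imports Complex_Main "HOL-Library.Poly_Mapping"
begin

section \<open>Bilinear maps and forms\<close>

text \<open>Vector spaces over a field are given, as in \<^theory>\<open>HOL.Vector_Spaces\<close>, by a scalar
  multiplication on the additive group of a whole type.  A bilinear form is a bilinear map into the
  field, regarded as a vector space over itself by multiplication.\<close>

definition bilinear_map ::
  "('k::field \<Rightarrow> 'a::ab_group_add \<Rightarrow> 'a) \<Rightarrow> ('k \<Rightarrow> 'b::ab_group_add \<Rightarrow> 'b) \<Rightarrow>
   ('k \<Rightarrow> 'c::ab_group_add \<Rightarrow> 'c) \<Rightarrow> ('a \<Rightarrow> 'b \<Rightarrow> 'c) \<Rightarrow> bool" where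
  "bilinear_map s1 s2 s3 f \<longleftrightarrow>
     (\<forall>x. Vector_Spaces.linear s2 s3 (\<lambda>y. f x y)) \<and> (\<forall>y. Vector_Spaces.linear s1 s3 (\<lambda>x. f x y))"

abbreviation bilinear_form ::
  "('k::field \<Rightarrow> 'a::ab_group_add \<Rightarrow> 'a) \<Rightarrow> ('a \<Rightarrow> 'a \<Rightarrow> 'k) \<Rightarrow> bool" where
  "bilinear_form s f \<equiv> bilinear_map s s (*) f"

definition symmetric_form :: "('a \<Rightarrow> 'a \<Rightarrow> 'k) \<Rightarrow> bool" where
  "symmetric_form f \<longleftrightarrow> (\<forall>x y. f x y = f y x)"

definition skewsymmetric_form :: "('a \<Rightarrow> 'a \<Rightarrow> 'k::ab_group_add) \<Rightarrow> bool" where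
  "skewsymmetric_form f \<longleftrightarrow> (\<forall>x y. f x y = - f y x)"

definition nondegenerate_form :: "('a::zero \<Rightarrow> 'a \<Rightarrow> 'k::zero) \<Rightarrow> bool" where
  "nondegenerate_form f \<longleftrightarrow>
     (\<forall>x. (\<forall>y. f x y = 0) \<longrightarrow> x = 0) \<and> (\<forall>y. (\<forall>x. f x y = 0) \<longrightarrow> y = 0)"

definition finite_dimensional ::
  "('k::field \<Rightarrow> 'a::ab_group_add \<Rightarrow> 'a) \<Rightarrow> 'a set \<Rightarrow> bool" where
  "finite_dimensional s V \<longleftrightarrow> (\<exists>S. finite S \<and> V = module.span s S)"


section \<open>Gradings by the integers\<close>

text \<open>\<open>G\<close> is the family of homogeneous components; the whole space is their internal direct sum,
  i.e. every vector is in exactly one way a finite sum of homogeneous vectors.\<close>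

locale graded_vector_space = vector_space scale
  for scale :: "'k::field \<Rightarrow> 'v::ab_group_add \<Rightarrow> 'v" +
  fixes G :: "int \<Rightarrow> 'v set"
  assumes component_subspace: "module.subspace scale (G i)"
    and component_finite_dimensional: "finite_dimensional scale (G i)"
    and direct_sum: "\<exists>!f. (\<forall>i. f i \<in> G i) \<and> finite {i. f i \<noteq> 0} \<and> x = (\<Sum>i | f i \<noteq> 0. f i)"

definition graded_form :: "(int \<Rightarrow> 'v set) \<Rightarrow> ('v \<Rightarrow> 'v \<Rightarrow> 'k::zero) \<Rightarrow> bool" where
  "graded_form G f \<longleftrightarrow> (\<exists>m. \<forall>i j. i + j + m \<noteq> 0 \<longrightarrow> (\<forall>x\<in>G i. \<forall>y\<in>G j. f x y = 0))"


section \<open>Novikov algebras and right Novikov algebras\<close>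

locale novikov_algebra = vector_space scale
  for scale :: "'k::field \<Rightarrow> 'a::ab_group_add \<Rightarrow> 'a" +
  fixes circ :: "'a \<Rightarrow> 'a \<Rightarrow> 'a"
  assumes circ_bilinear: "bilinear_map scale scale scale circ"
    and left_symmetric:
      "circ (circ a b) c - circ a (circ b c) = circ (circ b a) c - circ b (circ a c)"
    and right_commutative: "circ (circ a b) c = circ (circ a c) b"

locale quasi_frobenius_novikov_algebra = novikov_algebra scale circ
  for scale :: "'k::field \<Rightarrow> 'a::ab_group_add \<Rightarrow> 'a" and circ :: "'a \<Rightarrow> 'a \<Rightarrow> 'a" +
  fixes \<omega> :: "'a \<Rightarrow> 'a \<Rightarrow> 'k"
  assumes form_bilinear: "bilinear_form scale \<omega>"
    and form_skewsymmetric: "skewsymmetric_form \<omega>"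
    and form_nondegenerate: "nondegenerate_form \<omega>"
    and form_quasi_frobenius: "\<omega> (circ a b) c - \<omega> (circ a c + circ c a) b + \<omega> (circ c b) a = 0"

locale right_novikov_algebra = vector_space scale
  for scale :: "'k::field \<Rightarrow> 'b::ab_group_add \<Rightarrow> 'b" +
  fixes dia :: "'b \<Rightarrow> 'b \<Rightarrow> 'b"
  assumes dia_bilinear: "bilinear_map scale scale scale dia"
    and right_symmetric:
      "dia (dia a b) c - dia a (dia b c) = dia (dia a c) b - dia a (dia c b)"
    and left_commutative: "dia a (dia b c) = dia b (dia a c)"

locale quadratic_graded_right_novikov_algebra =
  right_novikov_algebra scale dia + graded_vector_space scale G
  for scale :: "'k::field \<Rightarrow> 'b::ab_group_add \<Rightarrow> 'b" and dia :: "'b \<Rightarrow> 'b \<Rightarrow> 'b"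
    and G :: "int \<Rightarrow> 'b set" +
  fixes form :: "'b \<Rightarrow> 'b \<Rightarrow> 'k"
  assumes dia_graded: "x \<in> G i \<Longrightarrow> y \<in> G j \<Longrightarrow> dia x y \<in> G (i + j)"
    and form_bilinear: "bilinear_form scale form"
    and form_symmetric: "symmetric_form form"
    and form_nondegenerate: "nondegenerate_form form"
    and form_graded: "graded_form G form"
    and form_invariant: "form (dia a b) c = - form a (dia b c + dia c b)"


section \<open>Quasi-Frobenius graded Lie algebras\<close>

locale graded_lie_algebra = graded_vector_space scale G
  for scale :: "'k::field \<Rightarrow> 'l::ab_group_add \<Rightarrow> 'l" and G :: "int \<Rightarrow> 'l set" +
  fixes bracket :: "'l \<Rightarrow> 'l \<Rightarrow> 'l"
  assumes bracket_bilinear: "bilinear_map scale scale scale bracket"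
    and bracket_alternating: "bracket x x = 0"
    and jacobi: "bracket x (bracket y z) + bracket y (bracket z x) + bracket z (bracket x y) = 0"
    and bracket_graded: "x \<in> G i \<Longrightarrow> y \<in> G j \<Longrightarrow> bracket x y \<in> G (i + j)"

locale quasi_frobenius_graded_lie_algebra = graded_lie_algebra scale G bracket
  for scale :: "'k::field \<Rightarrow> 'l::ab_group_add \<Rightarrow> 'l" and G :: "int \<Rightarrow> 'l set"
    and bracket :: "'l \<Rightarrow> 'l \<Rightarrow> 'l" +
  fixes form :: "'l \<Rightarrow> 'l \<Rightarrow> 'k"
  assumes form_bilinear: "bilinear_form scale form"
    and form_skewsymmetric: "skewsymmetric_form form"
    and form_nondegenerate: "nondegenerate_form form"
    and form_graded: "graded_form G form"
    and form_quasi_frobenius: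
      "form (bracket a b) c + form (bracket c a) b + form (bracket b c) a = 0"


section \<open>Tensor products\<close>

text \<open>\<open>'x \<Rightarrow>\<^sub>0 'k\<close> is the free vector space on \<open>'x\<close>, with basis vectors \<open>Poly_Mapping.single x 1\<close>
  and the following scalar multiplication.\<close>

definition free_scale :: "'k::field \<Rightarrow> ('x \<Rightarrow>\<^sub>0 'k) \<Rightarrow> ('x \<Rightarrow>\<^sub>0 'k)" where
  "free_scale c = Poly_Mapping.map ((*) c)"

lemma lookup_free_scale [simp]:
  "Poly_Mapping.lookup (free_scale c f) x = c * Poly_Mapping.lookup f x"
  by (simp add: free_scale_def Poly_Mapping.map.rep_eq when_def)

interpretation free: vector_space "free_scale :: 'k::field \<Rightarrow> ('x \<Rightarrow>\<^sub>0 'k) \<Rightarrow> ('x \<Rightarrow>\<^sub>0 'k)"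
  by unfold_locales (auto intro!: poly_mapping_eqI simp: lookup_add algebra_simps)

definition tensor_relations ::
  "('k::field \<Rightarrow> 'a::ab_group_add \<Rightarrow> 'a) \<Rightarrow> ('k \<Rightarrow> 'b::ab_group_add \<Rightarrow> 'b) \<Rightarrow>
   ('a \<times> 'b \<Rightarrow>\<^sub>0 'k) set" where
  "tensor_relations sA sB = (let e = (\<lambda>a b. Poly_Mapping.single (a, b) 1) in
     {e (a + a') b - e a b - e a' b | a a' b. True} \<union>
     {e a (b + b') - e a b - e a b' | a b b'. True} \<union>
     {e (sA c a) b - free_scale c (e a b) | c a b. True} \<union>
     {e a (sB c b) - free_scale c (e a b) | c a b. True})"

text \<open>The linear map from the free vector space on \<open>A \<times> B\<close> that sends the basis vector
  \<open>(a, b)\<close> to \<open>tens a b\<close>.\<close>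

definition tensor_eval ::
  "('k::field \<Rightarrow> 'l::ab_group_add \<Rightarrow> 'l) \<Rightarrow> ('a \<Rightarrow> 'b \<Rightarrow> 'l) \<Rightarrow> ('a \<times> 'b \<Rightarrow>\<^sub>0 'k) \<Rightarrow> 'l" where
  "tensor_eval sL tens u =
     (\<Sum>p\<in>Poly_Mapping.keys u. sL (Poly_Mapping.lookup u p) (tens (fst p) (snd p)))"

text \<open>The tensor product \<open>A \<otimes> B\<close> is the free vector space on \<open>A \<times> B\<close> modulo the span of the
  bilinearity relations.  This quotient depends on the scalar multiplications, so it is not a type;
  instead, \<open>tensor_product sA sB sL tens\<close> says that the vector space \<open>L\<close> is this quotient
  and that \<open>tens a b\<close> is the class of \<open>(a, b)\<close>.  The universal property is derived below.\<close>

locale tensor_product =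
  A: vector_space sA + B: vector_space sB + L: vector_space sL
  for sA :: "'k::field \<Rightarrow> 'a::ab_group_add \<Rightarrow> 'a" and sB :: "'k \<Rightarrow> 'b::ab_group_add \<Rightarrow> 'b"
    and sL :: "'k \<Rightarrow> 'l::ab_group_add \<Rightarrow> 'l" +
  fixes tens :: "'a \<Rightarrow> 'b \<Rightarrow> 'l"
  assumes tensor_eval_surj: "surj (tensor_eval sL tens)"
    and tensor_eval_kernel:
      "{u. tensor_eval sL tens u = 0} = module.span free_scale (tensor_relations sA sB)"

lemma tensor_eval_linear:
  assumes "vector_space sL"
  shows "Vector_Spaces.linear free_scale sL (tensor_eval sL tens)"
proof -
  interpret L: vector_space sL by fact
  have sup: "tensor_eval sL tens u =
      (\<Sum>p\<in>S. sL (Poly_Mapping.lookup u p) (tens (fst p) (snd p)))"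
    if "finite S" "Poly_Mapping.keys u \<subseteq> S" for u S
    unfolding tensor_eval_def using that
    by (intro sum.mono_neutral_left) (auto simp: in_keys_iff)
  have add: "tensor_eval sL tens (u + v) = tensor_eval sL tens u + tensor_eval sL tens v" for u v
  proof -
    let ?S = "Poly_Mapping.keys u \<union> Poly_Mapping.keys v"
    show ?thesis
      using sup[of ?S u] sup[of ?S v] sup[of ?S "u + v"] keys_add[of u v]
      by (simp add: lookup_add L.scale_left_distrib sum.distrib)
  qed
  have scale: "tensor_eval sL tens (free_scale c u) = sL c (tensor_eval sL tens u)" for c u
  proof -
    have "Poly_Mapping.keys (free_scale c u) \<subseteq> Poly_Mapping.keys u"
      by (auto simp: in_keys_iff)
    then show ?thesis
      using sup[of "Poly_Mapping.keys u" "free_scale c u"] sup[of "Poly_Mapping.keys u" u]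
      by (simp add: L.scale_sum_right)
  qed
  show ?thesis
    unfolding Vector_Spaces.linear_iff
    using add scale assms free.vector_space_axioms by blast
qed

lemma tensor_eval_single [simp]:
  assumes "vector_space sL"
  shows "tensor_eval sL tens (Poly_Mapping.single (a, b) 1) = tens a b"
proof -
  interpret L: vector_space sL by fact
  show ?thesis by (simp add: tensor_eval_def)
qed

lemma tensor_eval_relations:
  assumes "bilinear_map sA sB sV f" "u \<in> module.span free_scale (tensor_relations sA sB)"
  shows "tensor_eval sV f u = 0"
proof -
  have V: "vector_space sV"
    and lin: "\<And>a b b'. f a (b + b') = f a b + f a b'" "\<And>a a' b. f (a + a') b = f a b + f a' b"
      "\<And>c a b. f a (sB c b) = sV c (f a b)" "\<And>c a b. f (sA c a) b = sV c (f a b)"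
    using assms(1) by (auto simp: bilinear_map_def Vector_Spaces.linear_iff)
  interpret T: Vector_Spaces.linear free_scale sV "tensor_eval sV f"
    using tensor_eval_linear[OF V] .
  have "tensor_eval sV f r = 0" if "r \<in> tensor_relations sA sB" for r
    using that by (auto simp: tensor_relations_def Let_def T.diff T.scale V lin)
  then show ?thesis
    using T.eq_0_on_span assms(2) by blast
qed

context tensor_product
begin

sublocale E: Vector_Spaces.linear free_scale sL "tensor_eval sL tens"
  using tensor_eval_linear[OF L.vector_space_axioms] .

lemma tens_bilinear: "bilinear_map sA sB sL tens"
proof -
  have rel: "tensor_eval sL tens r = 0" if "r \<in> tensor_relations sA sB" for r
    using free.span_base[OF that] tensor_eval_kernel by auto
  note single = tensor_eval_single[OF L.vector_space_axioms]
  let ?e = "\<lambda>a b. Poly_Mapping.single (a, b) (1 :: 'k)"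
  have "tens (a + a') b = tens a b + tens a' b" for a a' b
  proof -
    have "?e (a + a') b - ?e a b - ?e a' b \<in> tensor_relations sA sB"
      unfolding tensor_relations_def Let_def by blast
    from rel[OF this] show ?thesis by (simp add: E.diff E.add single diff_diff_eq)
  qed
  moreover have "tens a (b + b') = tens a b + tens a b'" for a b b'
  proof -
    have "?e a (b + b') - ?e a b - ?e a b' \<in> tensor_relations sA sB"
      unfolding tensor_relations_def Let_def by blast
    from rel[OF this] show ?thesis by (simp add: E.diff E.add single diff_diff_eq)
  qed
  moreover have "tens (sA c a) b = sL c (tens a b)" for c a b
  proof -
    have "?e (sA c a) b - free_scale c (?e a b) \<in> tensor_relations sA sB"
      unfolding tensor_relations_def Let_def by blast
    from rel[OF this] show ?thesis by (simp add: E.diff E.scale single)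
  qed
  moreover have "tens a (sB c b) = sL c (tens a b)" for c a b
  proof -
    have "?e a (sB c b) - free_scale c (?e a b) \<in> tensor_relations sA sB"
      unfolding tensor_relations_def Let_def by blast
    from rel[OF this] show ?thesis by (simp add: E.diff E.scale single)
  qed
  ultimately show ?thesis
    unfolding bilinear_map_def Vector_Spaces.linear_iff
    using A.vector_space_axioms B.vector_space_axioms L.vector_space_axioms by blast
qed

lemma tens_span: "module.span sL {tens a b | a b. True} = UNIV"
proof -
  have "x \<in> L.span {tens a b | a b. True}" for x
  proof -
    obtain u where "x = tensor_eval sL tens u" using tensor_eval_surj by (metis surjD)
    moreover have "tensor_eval sL tens u \<in> L.span {tens a b | a b. True}"
      unfolding tensor_eval_def by (intro L.span_sum L.span_scale L.span_base) blast
    ultimately show ?thesis by simp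
  qed
  then show ?thesis by blast
qed

lemma linear_eq_on_tens:
  assumes "Vector_Spaces.linear sL sV g" "Vector_Spaces.linear sL sV h"
    and "\<And>a b. g (tens a b) = h (tens a b)"
  shows "g = h"
proof
  fix x
  interpret vector_space_pair sL sV
    using assms(1) by (simp add: vector_space_pair_def Vector_Spaces.linear_iff)
  show "g x = h x"
    by (rule linear_eq_on[OF assms(1,2), of x "{tens a b | a b. True}"])
      (use assms(3) tens_span in auto)
qed

lemma tensor_universal:
  assumes "bilinear_map sA sB sV f"
  shows "\<exists>!g. Vector_Spaces.linear sL sV g \<and> (\<forall>a b. g (tens a b) = f a b)"
proof -
  have V: "vector_space sV"
    using assms by (auto simp: bilinear_map_def Vector_Spaces.linear_iff)
  interpret T: Vector_Spaces.linear free_scale sV "tensor_eval sV f"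
    using tensor_eval_linear[OF V] .
  define g where "g = (\<lambda>x. tensor_eval sV f (inv (tensor_eval sL tens) x))"
  have g: "g (tensor_eval sL tens u) = tensor_eval sV f u" for u
  proof -
    let ?v = "inv (tensor_eval sL tens) (tensor_eval sL tens u)"
    have "tensor_eval sL tens (?v - u) = 0"
      by (simp add: E.diff surj_f_inv_f[OF tensor_eval_surj])
    then have "?v - u \<in> module.span free_scale (tensor_relations sA sB)"
      using tensor_eval_kernel by blast
    from tensor_eval_relations[OF assms this] show ?thesis
      by (simp add: g_def T.diff)
  qed
  have "g (x + y) = g x + g y" for x y
  proof -
    obtain u v where "x = tensor_eval sL tens u" "y = tensor_eval sL tens v"
      using tensor_eval_surj by (metis surjD)
    then show ?thesis by (simp only: g E.add[symmetric] T.add)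
  qed
  moreover have "g (sL c x) = sV c (g x)" for c x
  proof -
    obtain u where "x = tensor_eval sL tens u"
      using tensor_eval_surj by (metis surjD)
    then show ?thesis by (simp only: g E.scale[symmetric] T.scale)
  qed
  ultimately have "Vector_Spaces.linear sL sV g"
    unfolding Vector_Spaces.linear_iff using V L.vector_space_axioms by blast
  moreover have "g (tens a b) = f a b" for a b
    using g[of "Poly_Mapping.single (a, b) 1"] V L.vector_space_axioms by simp
  ultimately show ?thesis
    by (intro ex1I[of _ g] conjI allI) (auto intro: linear_eq_on_tens[where sV = sV])
qed

lemma tensor_universal2:
  assumes 1: "\<And>a b. bilinear_map sA sB sV (F a b)"
    and 2: "\<And>a' b'. bilinear_map sA sB sV (\<lambda>a b. F a b a' b')"
  shows "\<exists>!h. bilinear_map sL sL sV h \<and>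
    (\<forall>a b a' b'. h (tens a b) (tens a' b') = F a b a' b')"
proof -
  define g where
    "g a b = (THE g. Vector_Spaces.linear sL sV g \<and> (\<forall>a' b'. g (tens a' b') = F a b a' b'))" for a b
  have g: "Vector_Spaces.linear sL sV (g a b)" "g a b (tens a' b') = F a b a' b'" for a b a' b'
    using theI'[OF tensor_universal[OF 1[of a b]]] by (auto simp: g_def)
  have V: "vector_space sV"
    using g(1) by (simp add: Vector_Spaces.linear_iff)
  interpret V: vector_space sV by fact
  interpret LV: vector_space_pair sL sV
    using V L.vector_space_axioms by (simp add: vector_space_pair_def)
  have F: "F (a + a1) b a' b' = F a b a' b' + F a1 b a' b'"
      "F a (b + b1) a' b' = F a b a' b' + F a b1 a' b'"
      "F (sA c a) b a' b' = sV c (F a b a' b')"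
      "F a (sB c b) a' b' = sV c (F a b a' b')" for a a1 b b1 a' b' c
    using 2[of a' b'] by (auto simp: bilinear_map_def Vector_Spaces.linear_iff)
  have g_bilin: "bilinear_map sA sB sV (\<lambda>a b. g a b y)" for y
  proof -
    have "g (a + a1) b = (\<lambda>y. g a b y + g a1 b y)" for a a1 b
      by (rule linear_eq_on_tens[where sV = sV])
        (auto simp: g F intro!: LV.linear_compose_add)
    moreover have "g a (b + b1) = (\<lambda>y. g a b y + g a b1 y)" for a b b1
      by (rule linear_eq_on_tens[where sV = sV])
        (auto simp: g F intro!: LV.linear_compose_add)
    moreover have "g (sA c a) b = (\<lambda>y. sV c (g a b y))" for a b c
      by (rule linear_eq_on_tens[where sV = sV])
        (auto simp: g F intro!: LV.linear_compose_scale_right)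
    moreover have "g a (sB c b) = (\<lambda>y. sV c (g a b y))" for a b c
      by (rule linear_eq_on_tens[where sV = sV])
        (auto simp: g F intro!: LV.linear_compose_scale_right)
    ultimately show ?thesis
      unfolding bilinear_map_def Vector_Spaces.linear_iff
      using A.vector_space_axioms B.vector_space_axioms V by simp
  qed
  define h where
    "h y = (THE h. Vector_Spaces.linear sL sV h \<and> (\<forall>a b. h (tens a b) = g a b y))" for y
  have h: "Vector_Spaces.linear sL sV (h y)" "h y (tens a b) = g a b y" for y a b
    using theI'[OF tensor_universal[OF g_bilin[of y]]] by (auto simp: h_def)
  have gl: "g a b (y + z) = g a b y + g a b z" "g a b (sL c y) = sV c (g a b y)" for a b y z c
    using g(1) by (auto simp: Vector_Spaces.linear_iff)
  have "h (y + z) = (\<lambda>x. h y x + h z x)" for y z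
    by (rule linear_eq_on_tens[where sV = sV]) (auto simp: h gl intro!: LV.linear_compose_add)
  moreover have "h (sL c y) = (\<lambda>x. sV c (h y x))" for c y
    by (rule linear_eq_on_tens[where sV = sV])
      (auto simp: h gl intro!: LV.linear_compose_scale_right)
  ultimately have bil: "bilinear_map sL sL sV (\<lambda>x y. h y x)"
    unfolding bilinear_map_def using h(1) V L.vector_space_axioms
    by (auto simp: Vector_Spaces.linear_iff)
  show ?thesis
  proof (intro ex1I[of _ "\<lambda>x y. h y x"] conjI allI bil)
    show "h (tens a' b') (tens a b) = F a b a' b'" for a b a' b'
      by (simp add: h g)
    fix k assume k: "bilinear_map sL sL sV k \<and>
      (\<forall>a b a' b'. k (tens a b) (tens a' b') = F a b a' b')"
    have "k (tens a b) = (\<lambda>y. h y (tens a b))" for a b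
      by (rule linear_eq_on_tens[where sV = sV])
        (use k bil in \<open>auto simp: bilinear_map_def h g\<close>)
    then have "(\<lambda>x. k x y) = h y" for y
      by (intro linear_eq_on_tens[where sV = sV])
        (use k h(1) in \<open>auto simp: bilinear_map_def\<close>)
    then show "k = (\<lambda>x y. h y x)" by (simp add: fun_eq_iff)
  qed
qed

end


section \<open>The induced Lie algebra and the induced form\<close>

text \<open>The bracket and the form on \<open>L = A \<otimes> B\<close> are the bilinear maps with the prescribed values
  on pure tensors; that there is exactly one such map is proved below.\<close>

definition induced_bracket ::
  "('k::field \<Rightarrow> 'l::ab_group_add \<Rightarrow> 'l) \<Rightarrow> ('a \<Rightarrow> 'b \<Rightarrow> 'l) \<Rightarrow> ('a \<Rightarrow> 'a \<Rightarrow> 'a) \<Rightarrow>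
   ('b \<Rightarrow> 'b \<Rightarrow> 'b) \<Rightarrow> 'l \<Rightarrow> 'l \<Rightarrow> 'l" where
  "induced_bracket sL tens circ dia = (THE br. bilinear_map sL sL sL br \<and>
     (\<forall>a1 b1 a2 b2. br (tens a1 b1) (tens a2 b2) =
        tens (circ a1 a2) (dia b1 b2) - tens (circ a2 a1) (dia b2 b1)))"

definition induced_form ::
  "('k::field \<Rightarrow> 'l::ab_group_add \<Rightarrow> 'l) \<Rightarrow> ('a \<Rightarrow> 'b \<Rightarrow> 'l) \<Rightarrow> ('a \<Rightarrow> 'a \<Rightarrow> 'k) \<Rightarrow>
   ('b \<Rightarrow> 'b \<Rightarrow> 'k) \<Rightarrow> 'l \<Rightarrow> 'l \<Rightarrow> 'k" where
  "induced_form sL tens \<omega> form = (THE f. bilinear_form sL f \<and>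
     (\<forall>a1 b1 a2 b2. f (tens a1 b1) (tens a2 b2) = \<omega> a1 a2 * form b1 b2))"

definition induced_grading ::
  "('k::field \<Rightarrow> 'l::ab_group_add \<Rightarrow> 'l) \<Rightarrow> ('a \<Rightarrow> 'b \<Rightarrow> 'l) \<Rightarrow> (int \<Rightarrow> 'b set) \<Rightarrow> int \<Rightarrow> 'l set" where
  "induced_grading sL tens G i = module.span sL {tens a b | a b. b \<in> G i}"

lemma (in tensor_product) induced_bracket_unique:
  assumes "bilinear_map sA sA sA circ" "bilinear_map sB sB sB dia"
  shows "\<exists>!br. bilinear_map sL sL sL br \<and>
    (\<forall>a1 b1 a2 b2. br (tens a1 b1) (tens a2 b2) =
       tens (circ a1 a2) (dia b1 b2) - tens (circ a2 a1) (dia b2 b1))"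
  using assms tens_bilinear
  by (intro tensor_universal2)
    (simp_all add: bilinear_map_def Vector_Spaces.linear_iff L.scale_right_diff_distrib)

lemma (in tensor_product) induced_form_unique:
  assumes "bilinear_form sA \<omega>" "bilinear_form sB form"
  shows "\<exists>!f. bilinear_form sL f \<and>
    (\<forall>a1 b1 a2 b2. f (tens a1 b1) (tens a2 b2) = \<omega> a1 a2 * form b1 b2)"
  using assms
  by (intro tensor_universal2)
    (simp_all add: bilinear_map_def Vector_Spaces.linear_iff algebra_simps)


section \<open>Laurent polynomials\<close>

text \<open>\<open>int \<Rightarrow>\<^sub>0 'k\<close> with \<^const>\<open>free_scale\<close> is the vector space of Laurent polynomials, with \<open>t\<^sup>i\<close> the
  basis vector at \<open>i\<close>.  The product and the form are the bilinear extensions of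
  \<open>(t\<^sup>i, t\<^sup>j) \<mapsto> i t\<^bsup>i+j-1\<^esup>\<close> and of \<open>(t\<^sup>i, t\<^sup>j) \<mapsto> \<delta>\<^bsub>i+j+1,0\<^esub>\<close>.\<close>

abbreviation laurent_monom :: "int \<Rightarrow> (int \<Rightarrow>\<^sub>0 'k::field)" where
  "laurent_monom i \<equiv> Poly_Mapping.single i 1"

definition laurent_dia :: "(int \<Rightarrow>\<^sub>0 'k::field) \<Rightarrow> (int \<Rightarrow>\<^sub>0 'k) \<Rightarrow> (int \<Rightarrow>\<^sub>0 'k)" where
  "laurent_dia f g = (\<Sum>i\<in>Poly_Mapping.keys f. \<Sum>j\<in>Poly_Mapping.keys g.
     free_scale (Poly_Mapping.lookup f i * Poly_Mapping.lookup g j)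
       (free_scale (of_int i) (laurent_monom (i + j - 1))))"

definition laurent_form :: "(int \<Rightarrow>\<^sub>0 'k::field) \<Rightarrow> (int \<Rightarrow>\<^sub>0 'k) \<Rightarrow> 'k" where
  "laurent_form f g = (\<Sum>i\<in>Poly_Mapping.keys f. \<Sum>j\<in>Poly_Mapping.keys g.
     Poly_Mapping.lookup f i * Poly_Mapping.lookup g j * (if i + j + 1 = 0 then 1 else 0))"

definition laurent_grading :: "int \<Rightarrow> (int \<Rightarrow>\<^sub>0 'k::field) set" where
  "laurent_grading i = module.span free_scale {laurent_monom (i + 1)}"

lemma laurent_dia_monom:
  "laurent_dia (laurent_monom i) (laurent_monom j) =
     free_scale (of_int i) (laurent_monom (i + j - 1))"
  by (simp add: laurent_dia_def)

lemma laurent_form_monom: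
  "laurent_form (laurent_monom i) (laurent_monom j) = (if i + j + 1 = 0 then 1 else 0)"
  by (simp add: laurent_form_def)

end

theory Submission
  imports Defs
begin

text \<open>Both the Jacobi identity and the cocycle identity on \<open>L = A \<otimes> B\<close> are trilinear, so they need only
  be checked on pure tensors (\<open>trilinear_zero_on_span\<close>).  There, each of them becomes a pairing
  between an identity of \<open>A\<close> and an identity of \<open>B\<close>.

  For Jacobi (\<open>induced_bracket_jacobi\<close>), left commutativity of \<open>B\<close> leaves only three triple products
  \<open>p\<^sub>k = b\<^sub>i \<diamond> (b\<^sub>j \<diamond> b\<^sub>k)\<close>, and right commutativity of \<open>A\<close> leaves only three products
  \<open>r\<^sub>i = (a\<^sub>i \<circ> a\<^sub>j) \<circ> a\<^sub>k\<close>.  The remaining identities turn the Jacobi sum into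
  \<open>(r\<^sub>1 - r\<^sub>2) \<otimes> p\<^sub>3 + r\<^sub>1 \<otimes> (p\<^sub>2 - p\<^sub>3)\<close> plus its cyclic rotations, which cancels.

  For the cocycle identity (\<open>induced_form_cocycle_tens\<close>), put \<open>u\<^sub>i = (b\<^sub>i \<diamond> b\<^sub>j, b\<^sub>k)\<close>.  Invariance and
  symmetry of the form on \<open>B\<close> make \<open>u\<^sub>i\<close> independent of the order of \<open>j\<close> and \<open>k\<close> and give
  \<open>u\<^sub>1 + u\<^sub>2 + u\<^sub>3 = 0\<close>.  The cyclic sum equals \<open>u\<^sub>1 C\<^sub>1 + u\<^sub>2 C\<^sub>2 + u\<^sub>3 C\<^sub>3\<close> with
  \<open>C\<^sub>i = \<omega>(a\<^sub>i \<circ> a\<^sub>j, a\<^sub>k) - \<omega>(a\<^sub>i \<circ> a\<^sub>k, a\<^sub>j)\<close> for cyclic \<open>(i, j, k)\<close>, and the quasi-Frobenius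
  identity of \<open>\<omega>\<close> says exactly that \<open>C\<^sub>1 = C\<^sub>3\<close>, hence by rotation that all three agree.  So the sum
  vanishes.  Conversely, the Laurent polynomials contain \<open>t\<close>, \<open>1\<close>, \<open>t\<^sup>-\<^sup>1\<close>, for which
  \<open>(u\<^sub>1, u\<^sub>2, u\<^sub>3) = (1, 0, -1)\<close>; the cocycle identity at these elements is \<open>C\<^sub>1 = C\<^sub>3\<close> again
  (\<open>quasi_frobenius_novikov_of_laurent\<close>).

  The linear algebra of \<open>L\<close> rests on a finite basis of \<open>A\<close>: it identifies \<open>L\<close> with a finite direct
  sum of copies of \<open>B\<close> (\<open>coordinates\<close>), so that the grading of \<open>B\<close> and the nondegeneracy of its form
  carry over componentwise.\<close>

section \<open>Multilinear maps and spanning sets\<close>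

lemma field_vector_space: "vector_space ((*) :: 'k::field \<Rightarrow> 'k \<Rightarrow> 'k)"
  by unfold_locales (auto simp: algebra_simps)

lemma bilinear_map_iff:
  "bilinear_map s1 s2 s3 f \<longleftrightarrow> vector_space s1 \<and> vector_space s2 \<and> vector_space s3 \<and>
     (\<forall>x x' y. f (x + x') y = f x y + f x' y) \<and> (\<forall>x y y'. f x (y + y') = f x y + f x y') \<and>
     (\<forall>c x y. f (s1 c x) y = s3 c (f x y)) \<and> (\<forall>c x y. f x (s2 c y) = s3 c (f x y))"
  unfolding bilinear_map_def Vector_Spaces.linear_iff by auto

lemma bilinear_map_simps:
  assumes "bilinear_map s1 s2 s3 f"
  shows "f (x + x') y = f x y + f x' y" "f x (y + y') = f x y + f x y'"
    "f (s1 c x) y = s3 c (f x y)" "f x (s2 c y) = s3 c (f x y)"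
    "f 0 y = 0" "f x 0 = 0" "f (- x) y = - f x y" "f x (- y) = - f x y"
    "f (x - x') y = f x y - f x' y" "f x (y - y') = f x y - f x y'"
    "f (\<Sum>i\<in>I. g i) y = (\<Sum>i\<in>I. f (g i) y)" "f x (\<Sum>i\<in>I. h i) = (\<Sum>i\<in>I. f x (h i))"
proof -
  interpret X: Vector_Spaces.linear s1 s3 "\<lambda>x. f x y" for y
    using assms by (simp add: bilinear_map_def)
  interpret Y: Vector_Spaces.linear s2 s3 "\<lambda>y. f x y" for x
    using assms by (simp add: bilinear_map_def)
  show "f (x + x') y = f x y + f x' y" "f x (y + y') = f x y + f x y'"
    "f (s1 c x) y = s3 c (f x y)" "f x (s2 c y) = s3 c (f x y)"
    "f 0 y = 0" "f x 0 = 0" "f (- x) y = - f x y" "f x (- y) = - f x y"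
    "f (x - x') y = f x y - f x' y" "f x (y - y') = f x y - f x y'"
    "f (\<Sum>i\<in>I. g i) y = (\<Sum>i\<in>I. f (g i) y)" "f x (\<Sum>i\<in>I. h i) = (\<Sum>i\<in>I. f x (h i))"
    by (fact X.add Y.add X.scale Y.scale X.zero Y.zero X.neg Y.neg X.diff Y.diff X.sum Y.sum)+
qed

lemma linear_span_into_subspace:
  assumes f: "Vector_Spaces.linear s1 s2 f" and W: "module.subspace s2 W"
    and x: "x \<in> module.span s1 S" and S: "\<And>u. u \<in> S \<Longrightarrow> f u \<in> W"
  shows "f x \<in> W"
proof -
  interpret Vector_Spaces.linear s1 s2 f by fact
  show ?thesis
    using span_image[of S] x vs2.span_minimal[OF _ W, of "f ` S"] S by blast
qed

lemma bilinear_span_into_subspace: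
  assumes f: "bilinear_map s1 s2 s3 f" and W: "module.subspace s3 W"
    and x: "x \<in> module.span s1 S" and y: "y \<in> module.span s2 T"
    and ST: "\<And>u v. u \<in> S \<Longrightarrow> v \<in> T \<Longrightarrow> f u v \<in> W"
  shows "f x y \<in> W"
proof -
  have lin: "Vector_Spaces.linear s1 s3 (\<lambda>x. f x v)"
    "Vector_Spaces.linear s2 s3 (\<lambda>y. f u y)" for u v
    using f by (simp_all add: bilinear_map_def)
  have "f x v \<in> W" if "v \<in> T" for v
    by (rule linear_span_into_subspace[OF lin(1) W x ST[OF _ that]])
  then show ?thesis
    by (rule linear_span_into_subspace[OF lin(2) W y])
qed

lemma trilinear_zero_on_span:
  assumes l1: "\<And>y z. Vector_Spaces.linear s v (\<lambda>x. T x y z)"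
    and l2: "\<And>x z. Vector_Spaces.linear s v (\<lambda>y. T x y z)"
    and l3: "\<And>x y. Vector_Spaces.linear s v (\<lambda>z. T x y z)"
    and S: "module.span s S = UNIV"
    and zero: "\<And>x y z. x \<in> S \<Longrightarrow> y \<in> S \<Longrightarrow> z \<in> S \<Longrightarrow> T x y z = 0"
  shows "T x y z = 0"
proof -
  interpret v: vector_space v using l1 by (auto simp: Vector_Spaces.linear_iff)
  have "T x y z \<in> {0}" if "y \<in> S" "z \<in> S" for x y z
    by (rule linear_span_into_subspace[OF l1 v.subspace_single_0, of x S]) (use S zero that in auto)
  then have "T x y z \<in> {0}" if "z \<in> S" for x y z
    by (intro linear_span_into_subspace[OF l2 v.subspace_single_0, of y S]) (use S that in auto)
  then have "T x y z \<in> {0}"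
    by (intro linear_span_into_subspace[OF l3 v.subspace_single_0, of z S]) (use S in auto)
  then show ?thesis by simp
qed

section \<open>Coordinates on a tensor product\<close>

context tensor_product
begin

lemmas tens_simps = bilinear_map_simps[OF tens_bilinear]

lemma in_tens_span: "x \<in> L.span {tens a b | a b. True}"
  by (simp only: tens_span UNIV_I)

text \<open>Over a finite basis \<open>E\<close> of \<open>A\<close> with coordinate functionals \<open>c e\<close>, the map
  \<open>\<psi> e = c e \<otimes> id\<close> reads off the coefficient in \<open>B\<close> of a tensor at \<open>e\<close>; it exists by the universal
  property.\<close>

lemma coordinates:
  assumes "finite_dimensional sA UNIV"
  obtains E c \<psi> where "finite E"
    "\<And>e. Vector_Spaces.linear sA (*) (c e)"
    "\<And>e. Vector_Spaces.linear sL sB (\<psi> e)"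
    "\<And>e a b. \<psi> e (tens a b) = sB (c e a) b"
    "\<And>x. x = (\<Sum>e\<in>E. tens e (\<psi> e x))"
proof -
  obtain S where S: "finite S" "A.span S = UNIV"
    using assms by (auto simp: finite_dimensional_def)
  obtain E where E: "E \<subseteq> S" "A.independent E" "S \<subseteq> A.span E"
    using A.maximal_independent_subset by blast
  have fin: "finite E" using E S finite_subset by blast
  have "UNIV \<subseteq> A.span E"
    using A.span_mono[OF E(3)] S(2) by (simp add: A.span_span)
  then have UN: "A.span E = UNIV" by blast
  define c where "c e a = A.representation E a e" for e a
  have k: "vector_space ((*) :: 'k \<Rightarrow> 'k \<Rightarrow> 'k)"
    by (rule field_vector_space)
  have c: "Vector_Spaces.linear sA (*) (c e)" for e
    unfolding Vector_Spaces.linear_iff c_def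
    using k A.vector_space_axioms
    by (simp add: A.representation_add A.representation_scale E UN)
  have cb: "bilinear_map sA sB sB (\<lambda>a b. sB (c e a) b)" for e
    using c[of e] B.vector_space_axioms
    by (auto simp: bilinear_map_iff Vector_Spaces.linear_iff B.scale_left_distrib
      B.scale_right_distrib B.scale_left_commute)
  from tensor_universal[OF cb] obtain \<psi> where
    \<psi>: "\<And>e. Vector_Spaces.linear sL sB (\<psi> e)" "\<And>e a b. \<psi> e (tens a b) = sB (c e a) b"
    by metis
  have p: "\<psi> e (x + y) = \<psi> e x + \<psi> e y" "\<psi> e (sL k x) = sB k (\<psi> e x)" for e k x y
    using \<psi>(1) by (auto simp: Vector_Spaces.linear_iff)
  have "(\<lambda>x. x) = (\<lambda>x. \<Sum>e\<in>E. tens e (\<psi> e x))"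
  proof (rule linear_eq_on_tens)
    show "Vector_Spaces.linear sL sL (\<lambda>x. x)" by (rule L.linear_ident)
    show "Vector_Spaces.linear sL sL (\<lambda>x. \<Sum>e\<in>E. tens e (\<psi> e x))"
      using L.vector_space_axioms
      by (simp add: Vector_Spaces.linear_iff p tens_simps sum.distrib L.scale_sum_right)
    fix a b
    have "(\<Sum>e\<in>E. sA (c e a) e) = a"
      unfolding c_def by (rule A.sum_representation_eq) (auto simp: E UN fin)
    then have "tens a b = (\<Sum>e\<in>E. tens (sA (c e a) e) b)"
      by (simp add: tens_simps(11)[symmetric])
    also have "\<dots> = (\<Sum>e\<in>E. tens e (\<psi> e (tens a b)))"
      by (simp add: \<psi> tens_simps)
    finally show "tens a b = (\<Sum>e\<in>E. tens e (\<psi> e (tens a b)))" .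
  qed
  then have "x = (\<Sum>e\<in>E. tens e (\<psi> e x))" for x by meson
  with that fin c \<psi> show thesis by blast
qed

end

section \<open>The grading of the tensor product\<close>

lemma (in graded_vector_space) decomposition_unique:
  assumes f: "\<And>i. f i \<in> G i" "finite {i. f i \<noteq> 0}"
    and g: "\<And>i. g i \<in> G i" "finite {i. g i \<noteq> 0}"
    and sum: "(\<Sum>i | f i \<noteq> 0. f i) = (\<Sum>i | g i \<noteq> 0. g i)"
  shows "f = g"
proof -
  obtain h where h: "\<And>u. (\<forall>i. u i \<in> G i) \<and> finite {i. u i \<noteq> 0} \<and>
      (\<Sum>i | f i \<noteq> 0. f i) = (\<Sum>i | u i \<noteq> 0. u i) \<Longrightarrow> u = h"
    using direct_sum[of "\<Sum>i | f i \<noteq> 0. f i"] by (elim ex1E) blast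
  have "f = h" by (rule h) (use f in blast)
  moreover have "g = h" by (rule h) (use g sum in blast)
  ultimately show ?thesis by simp
qed

context tensor_product
begin

lemma tens_in_induced_grading: "b \<in> G i \<Longrightarrow> tens a b \<in> induced_grading sL tens G i"
  unfolding induced_grading_def by (rule L.span_base) blast

text \<open>The homogeneous components of \<open>x\<close> are obtained by splitting each coordinate \<open>\<psi> e x\<close> in \<open>B\<close> and
  reassembling.  They are unique because \<open>\<psi> e\<close> maps the component of degree \<open>i\<close> of \<open>L\<close> into \<open>G i\<close>, so
  that any decomposition of \<open>x\<close> induces one of \<open>\<psi> e x\<close>.\<close>

lemma graded_vector_space_tensor:
  assumes fA: "finite_dimensional sA UNIV" and "graded_vector_space sB G"
  shows "graded_vector_space sL (induced_grading sL tens G)"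
proof -
  interpret G: graded_vector_space sB G by fact
  show ?thesis
  proof
    fix i
    show sub: "L.subspace (induced_grading sL tens G i)"
      by (simp add: induced_grading_def)
    obtain S T where S: "finite S" "A.span S = UNIV" and T: "finite T" "G i = B.span T"
      using fA G.component_finite_dimensional[of i] by (auto simp: finite_dimensional_def)
    let ?ST = "(\<lambda>(a, b). tens a b) ` (S \<times> T)"
    have "tens a b \<in> L.span ?ST" if "b \<in> G i" for a b
      by (rule bilinear_span_into_subspace[OF tens_bilinear L.subspace_span, of a S b T])
        (use S T that in \<open>auto intro!: L.span_base\<close>)
    then have "induced_grading sL tens G i \<subseteq> L.span ?ST"
      unfolding induced_grading_def by (intro L.span_minimal) auto
    moreover have "L.span ?ST \<subseteq> induced_grading sL tens G i"
      using T by (intro L.span_minimal sub) (auto intro!: tens_in_induced_grading B.span_base)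
    ultimately show "finite_dimensional sL (induced_grading sL tens G i)"
      unfolding finite_dimensional_def using S T by (intro exI[of _ ?ST]) auto
  next
    fix x
    obtain E c \<psi> where E: "finite E" and "\<And>e. Vector_Spaces.linear sA (*) (c e)"
      and \<psi>: "\<And>e. Vector_Spaces.linear sL sB (\<psi> e)" "\<And>e a b. \<psi> e (tens a b) = sB (c e a) b"
      and expand: "\<And>x. x = (\<Sum>e\<in>E. tens e (\<psi> e x))"
      by (rule coordinates[OF fA]) (rule that; assumption)
    interpret \<psi>: Vector_Spaces.linear sL sB "\<psi> e" for e by (rule \<psi>)
    have "\<exists>g. (\<forall>i. g i \<in> G i) \<and> finite {i. g i \<noteq> 0} \<and> \<psi> e x = (\<Sum>i | g i \<noteq> 0. g i)" for e
      using G.direct_sum by blast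
    then obtain g where g: "\<And>e i. g e i \<in> G i" "\<And>e. finite {i. g e i \<noteq> 0}"
      "\<And>e. \<psi> e x = (\<Sum>i | g e i \<noteq> 0. g e i)"
      by metis
    define f where "f i = (\<Sum>e\<in>E. tens e (g e i))" for i
    show "\<exists>!f. (\<forall>i. f i \<in> induced_grading sL tens G i) \<and> finite {i. f i \<noteq> 0} \<and>
      x = (\<Sum>i | f i \<noteq> 0. f i)"
    proof (intro ex1I[of _ f] conjI allI)
      fix i
      show "f i \<in> induced_grading sL tens G i"
        unfolding f_def induced_grading_def using g(1)
        by (intro L.span_sum L.span_base) blast
    next
      let ?I = "\<Union>e\<in>E. {i. g e i \<noteq> 0}"
      have I: "finite ?I" using E g by auto
      have "f i = 0" if "i \<notin> ?I" for i
        unfolding f_def using that by (intro sum.neutral) (auto simp: tens_simps)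
      then have sub: "{i. f i \<noteq> 0} \<subseteq> ?I" by blast
      show "finite {i. f i \<noteq> 0}" using sub I finite_subset by blast
      have "(\<Sum>i | f i \<noteq> 0. f i) = (\<Sum>i\<in>?I. f i)"
        using I sub by (intro sum.mono_neutral_left) auto
      also have "\<dots> = (\<Sum>e\<in>E. tens e (\<Sum>i\<in>?I. g e i))"
        unfolding f_def by (subst sum.swap) (simp add: tens_simps)
      also have "\<dots> = (\<Sum>e\<in>E. tens e (\<psi> e x))"
      proof (intro sum.cong refl arg_cong[where f = "tens _"])
        fix e assume "e \<in> E"
        then show "(\<Sum>i\<in>?I. g e i) = \<psi> e x"
          unfolding g(3) using I by (intro sum.mono_neutral_right) auto
      qed
      also have "\<dots> = x" by (rule expand[symmetric])
      finally show "x = (\<Sum>i | f i \<noteq> 0. f i)" by simp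
    next
      fix f' assume f': "(\<forall>i. f' i \<in> induced_grading sL tens G i) \<and> finite {i. f' i \<noteq> 0} \<and>
        x = (\<Sum>i | f' i \<noteq> 0. f' i)"
      have "\<psi> e (f' i) = g e i" for e i
      proof -
        have mem: "\<psi> e (f' i) \<in> G i" for i
          by (rule linear_span_into_subspace[OF \<psi>(1) G.component_subspace])
            (use f' B.subspace_scale[OF G.component_subspace] in
              \<open>auto simp: induced_grading_def \<psi>(2)\<close>)
        have sub: "{i. \<psi> e (f' i) \<noteq> 0} \<subseteq> {i. f' i \<noteq> 0}" by (auto simp: \<psi>.zero)
        have "\<psi> e x = (\<Sum>i | f' i \<noteq> 0. \<psi> e (f' i))"
          using f' \<psi>.sum[of e f' "{i. f' i \<noteq> 0}"] by simp
        also have "\<dots> = (\<Sum>i | \<psi> e (f' i) \<noteq> 0. \<psi> e (f' i))"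
          using f' sub by (intro sum.mono_neutral_right) auto
        finally have "\<psi> e x = (\<Sum>i | \<psi> e (f' i) \<noteq> 0. \<psi> e (f' i))" .
        moreover have "finite {i. \<psi> e (f' i) \<noteq> 0}" using sub f' finite_subset by blast
        ultimately have "(\<lambda>i. \<psi> e (f' i)) = g e"
          by (intro G.decomposition_unique mem g(1,2)) (simp_all only: g(3))
        then show ?thesis by (rule fun_cong)
      qed
      then have "(\<Sum>e\<in>E. tens e (\<psi> e (f' i))) = f i" for i
        by (simp add: f_def)
      then have "f' i = f i" for i
        by (rule trans[OF expand])
      then show "f' = f" by (rule ext)
    qed
  qed
qed

section \<open>The induced Lie bracket\<close>

lemma
  assumes "bilinear_map sA sA sA circ" "bilinear_map sB sB sB dia"
  shows induced_bracket_bilinear: "bilinear_map sL sL sL (induced_bracket sL tens circ dia)"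
    and induced_bracket_tens: "induced_bracket sL tens circ dia (tens a1 b1) (tens a2 b2) =
      tens (circ a1 a2) (dia b1 b2) - tens (circ a2 a1) (dia b2 b1)"
  using theI'[OF induced_bracket_unique[OF assms]] unfolding induced_bracket_def by blast+

lemma induced_bracket_jacobi:
  assumes "novikov_algebra sA circ" "right_novikov_algebra sB dia"
  defines "br \<equiv> induced_bracket sL tens circ dia"
  shows "br x (br y z) + br y (br z x) + br z (br x y) = 0"
proof -
  interpret N: novikov_algebra sA circ by fact
  interpret R: right_novikov_algebra sB dia by fact
  note bil = induced_bracket_bilinear[OF N.circ_bilinear R.dia_bilinear, folded br_def]
  note brt = induced_bracket_tens[OF N.circ_bilinear R.dia_bilinear, folded br_def]
  note br = bilinear_map_simps(1-10)[OF bil]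
  show ?thesis
  proof (rule trilinear_zero_on_span[where s = sL and v = sL and S = "{tens a b | a b. True}"
        and T = "\<lambda>x y z. br x (br y z) + br y (br z x) + br z (br x y)"])
    show "module.span sL {tens a b |a b. True} = UNIV" by (rule tens_span)
  next
    fix x y z assume "x \<in> {tens a b |a b. True}" "y \<in> {tens a b |a b. True}"
      "z \<in> {tens a b |a b. True}"
    then obtain a1 b1 a2 b2 a3 b3 where
      xyz: "x = tens a1 b1" "y = tens a2 b2" "z = tens a3 b3" by blast
    \<comment> \<open>Each of \<open>l\<close>, \<open>r\<close>, \<open>p\<close>, \<open>q\<close> is oriented towards a fixed set of representatives: the three
      products \<open>a\<^sub>i (a\<^sub>j a\<^sub>k)\<close> and three products \<open>(a\<^sub>i a\<^sub>j) a\<^sub>k\<close> in \<open>A\<close>, and likewise in \<open>B\<close>.  Once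
      everything is written in these, the sum cancels by bilinearity alone.\<close>
    have l: "circ a2 (circ a1 a3) =
        circ a1 (circ a2 a3) - circ (circ a1 a2) a3 + circ (circ a2 a1) a3"
      "circ a3 (circ a2 a1) =
        circ a2 (circ a3 a1) - circ (circ a2 a1) a3 + circ (circ a3 a1) a2"
      "circ a1 (circ a3 a2) =
        circ a3 (circ a1 a2) - circ (circ a3 a1) a2 + circ (circ a1 a2) a3"
      using N.left_symmetric[of a1 a2 a3] N.left_symmetric[of a2 a3 a1]
        N.left_symmetric[of a3 a1 a2] N.right_commutative[of a1 a3 a2]
        N.right_commutative[of a2 a3 a1] N.right_commutative[of a3 a2 a1]
      by (simp_all add: algebra_simps)
    have r: "circ (circ a1 a3) a2 = circ (circ a1 a2) a3"
      "circ (circ a2 a3) a1 = circ (circ a2 a1) a3"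
      "circ (circ a3 a2) a1 = circ (circ a3 a1) a2"
      by (rule N.right_commutative)+
    have p: "dia b2 (dia b1 b3) = dia b1 (dia b2 b3)" "dia b3 (dia b1 b2) = dia b1 (dia b3 b2)"
      "dia b3 (dia b2 b1) = dia b2 (dia b3 b1)"
      by (rule R.left_commutative)+
    have q: "dia (dia b1 b3) b2 = dia (dia b1 b2) b3 - dia b1 (dia b2 b3) + dia b1 (dia b3 b2)"
      "dia (dia b2 b3) b1 = dia (dia b2 b1) b3 - dia b1 (dia b2 b3) + dia b2 (dia b3 b1)"
      "dia (dia b3 b2) b1 = dia (dia b3 b1) b2 - dia b1 (dia b3 b2) + dia b2 (dia b3 b1)"
      using R.right_symmetric[of b1 b2 b3] R.right_symmetric[of b2 b1 b3]
        R.right_symmetric[of b3 b1 b2] p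
      by (simp_all add: algebra_simps)
    show "br x (br y z) + br y (br z x) + br z (br x y) = 0"
      unfolding xyz by (simp add: brt br l r p q tens_simps(1-10) algebra_simps)
  qed (use L.vector_space_axioms in
      \<open>simp_all add: Vector_Spaces.linear_iff br L.scale_right_distrib algebra_simps\<close>)
qed

lemma graded_lie_algebra_tensor:
  assumes char0: "(2 :: 'k) \<noteq> 0"
    and fA: "finite_dimensional sA UNIV" and "novikov_algebra sA circ"
    and "right_novikov_algebra sB dia" and G: "graded_vector_space sB G"
    and dia_graded: "\<And>i j x y. x \<in> G i \<Longrightarrow> y \<in> G j \<Longrightarrow> dia x y \<in> G (i + j)"
  shows "graded_lie_algebra sL (induced_grading sL tens G) (induced_bracket sL tens circ dia)"
proof -
  interpret N: novikov_algebra sA circ by fact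
  interpret R: right_novikov_algebra sB dia by fact
  let ?br = "induced_bracket sL tens circ dia"
  interpret V: graded_vector_space sL "induced_grading sL tens G"
    by (rule graded_vector_space_tensor[OF fA G])
  note bil = induced_bracket_bilinear[OF N.circ_bilinear R.dia_bilinear]
  note brt = induced_bracket_tens[OF N.circ_bilinear R.dia_bilinear]
  note br = bilinear_map_simps(1-10)[OF bil]
  show ?thesis
  proof
    fix x y z
    show "bilinear_map sL sL sL ?br" by (rule bil)
    have "?br x y + ?br y x = 0" for x y
    proof -
      have "bilinear_map sL sL sL (\<lambda>x y. ?br x y + ?br y x)"
        using L.vector_space_axioms by (simp add: bilinear_map_iff br algebra_simps)
      then have "?br x y + ?br y x \<in> {0}"
        by (rule bilinear_span_into_subspace[OF _ L.subspace_single_0 in_tens_span in_tens_span])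
          (auto simp: brt)
      then show ?thesis by simp
    qed
    \<comment> \<open>Antisymmetry is bilinear and can be tested on pure tensors, unlike \<open>[x, x] = 0\<close>, which follows
      from it because \<open>2\<close> is invertible.\<close>
    from this[of x x] have "sL 2 (?br x x) = 0"
      using L.scale_left_distrib[of 1 1 "?br x x"] by simp
    with char0 show "?br x x = 0" by simp
    show "?br x (?br y z) + ?br y (?br z x) + ?br z (?br x y) = 0"
      by (rule induced_bracket_jacobi) fact+
    fix i j
    assume x: "x \<in> induced_grading sL tens G i" and y: "y \<in> induced_grading sL tens G j"
    show "?br x y \<in> induced_grading sL tens G (i + j)"
    proof (rule bilinear_span_into_subspace[OF bil V.component_subspace
          x[unfolded induced_grading_def] y[unfolded induced_grading_def]])
      fix u v assume "u \<in> {tens a b | a b. b \<in> G i}" "v \<in> {tens a b | a b. b \<in> G j}"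
      then obtain a b a' b' where uv: "u = tens a b" "v = tens a' b'" "b \<in> G i" "b' \<in> G j"
        by blast
      then have "dia b b' \<in> G (i + j)" "dia b' b \<in> G (i + j)"
        using dia_graded[of b i b' j] dia_graded[of b' j b i] by (simp_all add: add.commute)
      then show "?br u v \<in> induced_grading sL tens G (i + j)"
        unfolding uv brt
        by (intro L.subspace_diff[OF V.component_subspace] tens_in_induced_grading)
    qed
  qed
qed

section \<open>The induced form\<close>

lemma
  assumes "bilinear_form sA \<omega>" "bilinear_form sB form"
  shows induced_form_bilinear: "bilinear_form sL (induced_form sL tens \<omega> form)"
    and induced_form_tens:
      "induced_form sL tens \<omega> form (tens a1 b1) (tens a2 b2) = \<omega> a1 a2 * form b1 b2"
  using theI'[OF induced_form_unique[OF assms]] unfolding induced_form_def by blast+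

lemma induced_form_skewsymmetric:
  assumes \<omega>: "bilinear_form sA \<omega>" "skewsymmetric_form \<omega>"
    and form: "bilinear_form sB form" "symmetric_form form"
  shows "skewsymmetric_form (induced_form sL tens \<omega> form)"
proof -
  let ?F = "induced_form sL tens \<omega> form"
  note bil = induced_form_bilinear[OF \<omega>(1) form(1)]
  note F = bilinear_map_simps(1-10)[OF bil]
  have k: "vector_space ((*) :: 'k \<Rightarrow> 'k \<Rightarrow> 'k)" by (rule field_vector_space)
  interpret k: vector_space "(*) :: 'k \<Rightarrow> 'k \<Rightarrow> 'k" by fact
  have "?F x y + ?F y x \<in> {0}" for x y
  proof (rule bilinear_span_into_subspace[OF _ k.subspace_single_0 in_tens_span in_tens_span,
        where f = "\<lambda>x y. ?F x y + ?F y x"])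
    show "bilinear_form sL (\<lambda>x y. ?F x y + ?F y x)"
      using L.vector_space_axioms k by (simp add: bilinear_map_iff F algebra_simps)
    fix u v assume "u \<in> {tens a b | a b. True}" "v \<in> {tens a b | a b. True}"
    then obtain a b a' b' where uv: "u = tens a b" "v = tens a' b'" by blast
    have "\<omega> a a' = - \<omega> a' a" "form b b' = form b' b"
      using \<omega>(2) form(2) unfolding skewsymmetric_form_def symmetric_form_def by blast+
    then show "?F u v + ?F v u \<in> {0}"
      by (simp add: uv induced_form_tens[OF \<omega>(1) form(1)])
  qed
  then show ?thesis by (simp add: skewsymmetric_form_def eq_neg_iff_add_eq_0)
qed

text \<open>For fixed \<open>b\<close>, contracting the second factor with \<open>form _ b\<close> gives \<open>\<phi> b : L \<rightarrow> A\<close>, and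
  \<open>(x, a \<otimes> b) = \<omega>(\<phi> b x, a)\<close>.  So if \<open>x\<close> is in the radical, every \<open>\<phi> b x\<close> is zero by nondegeneracy of
  \<open>\<omega>\<close>.  The coordinate of \<open>\<phi> b x\<close> at a basis vector \<open>e\<close> is \<open>(\<psi> e x, b)\<close>, whence every \<open>\<psi> e x\<close> is zero
  by nondegeneracy on \<open>B\<close>, and with it \<open>x\<close>.\<close>

lemma induced_form_nondegenerate:
  assumes fA: "finite_dimensional sA UNIV"
    and \<omega>: "bilinear_form sA \<omega>" "skewsymmetric_form \<omega>" "nondegenerate_form \<omega>"
    and form: "bilinear_form sB form" "symmetric_form form" "nondegenerate_form form"
  shows "nondegenerate_form (induced_form sL tens \<omega> form)"
proof -
  let ?F = "induced_form sL tens \<omega> form"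
  note bil = induced_form_bilinear[OF \<omega>(1) form(1)]
  note w = bilinear_map_simps(1-10)[OF \<omega>(1)] and f = bilinear_map_simps(1-10)[OF form(1)]
  have k: "vector_space ((*) :: 'k \<Rightarrow> 'k \<Rightarrow> 'k)" by (rule field_vector_space)
  obtain E c \<psi> where "finite E" and c: "\<And>e. Vector_Spaces.linear sA (*) (c e)"
    and \<psi>: "\<And>e. Vector_Spaces.linear sL sB (\<psi> e)" "\<And>e a b. \<psi> e (tens a b) = sB (c e a) b"
    and expand: "\<And>x. x = (\<Sum>e\<in>E. tens e (\<psi> e x))"
    by (rule coordinates[OF fA]) (rule that; assumption)
  interpret C: Vector_Spaces.linear sA "(*)" "c e" for e by (rule c)
  have "bilinear_map sA sB sA (\<lambda>a b'. sA (form b' b) a)" for b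
    using A.vector_space_axioms B.vector_space_axioms
    by (simp add: bilinear_map_iff f A.scale_right_distrib A.scale_left_distrib mult.commute)
  from tensor_universal[OF this] obtain \<phi> where
    \<phi>: "\<And>b. Vector_Spaces.linear sL sA (\<phi> b)" "\<And>b a b'. \<phi> b (tens a b') = sA (form b' b) a"
    by metis
  have zero: "x = 0" if x: "\<And>y. ?F x y = 0" for x
  proof -
    have pair: "(\<lambda>x. \<omega> (\<phi> b x) a) = (\<lambda>x. ?F x (tens a b))" for a b
    proof (rule linear_eq_on_tens[where sV = "(*)"])
      show "Vector_Spaces.linear sL (*) (\<lambda>x. \<omega> (\<phi> b x) a)"
        using \<phi>(1)[of b] k by (simp add: Vector_Spaces.linear_iff w)
      show "Vector_Spaces.linear sL (*) (\<lambda>x. ?F x (tens a b))"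
        using bil by (simp add: bilinear_map_def)
      show "\<omega> (\<phi> b (tens a' b')) a = ?F (tens a' b') (tens a b)" for a' b'
        by (simp add: \<phi> w induced_form_tens[OF \<omega>(1) form(1)])
    qed
    have "\<omega> (\<phi> b x) a = 0" for a b using fun_cong[OF pair[of b a], of x] x by simp
    then have \<phi>0: "\<phi> b x = 0" for b
      using \<omega>(3) unfolding nondegenerate_form_def by blast
    have coord: "(\<lambda>x. form (\<psi> e x) b) = (\<lambda>x. c e (\<phi> b x))" for e b
    proof (rule linear_eq_on_tens[where sV = "(*)"])
      show "Vector_Spaces.linear sL (*) (\<lambda>x. form (\<psi> e x) b)"
        using \<psi>(1)[of e] k by (simp add: Vector_Spaces.linear_iff f)
      show "Vector_Spaces.linear sL (*) (\<lambda>x. c e (\<phi> b x))"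
        using \<phi>(1)[of b] c[of e] by (simp add: Vector_Spaces.linear_iff)
      show "form (\<psi> e (tens a b')) b = c e (\<phi> b (tens a b'))" for a b'
        using c[of e] by (simp add: \<psi> \<phi> f Vector_Spaces.linear_iff)
    qed
    have "form (\<psi> e x) b = 0" for e b
      using fun_cong[OF coord[of e b], of x] \<phi>0[of b] by (simp add: C.zero)
    then have "\<psi> e x = 0" for e
      using form(3) unfolding nondegenerate_form_def by blast
    then show "x = 0" using expand[of x] by (simp add: tens_simps)
  qed
  have "?F x y = - ?F y x" for x y
    using induced_form_skewsymmetric[OF \<omega>(1,2) form(1,2)]
    unfolding skewsymmetric_form_def by blast
  then show ?thesis
    unfolding nondegenerate_form_def using zero by (metis neg_equal_0_iff_equal)
qed

lemma induced_form_graded: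
  assumes \<omega>: "bilinear_form sA \<omega>" and form: "bilinear_form sB form" "graded_form G form"
  shows "graded_form (induced_grading sL tens G) (induced_form sL tens \<omega> form)"
proof -
  note bil = induced_form_bilinear[OF \<omega> form(1)]
  interpret k: vector_space "(*) :: 'k \<Rightarrow> 'k \<Rightarrow> 'k" by (rule field_vector_space)
  obtain m where m: "\<And>i j x y. i + j + m \<noteq> 0 \<Longrightarrow> x \<in> G i \<Longrightarrow> y \<in> G j \<Longrightarrow> form x y = 0"
    using form(2) unfolding graded_form_def by blast
  have "induced_form sL tens \<omega> form x y \<in> {0}"
    if "i + j + m \<noteq> 0" "x \<in> induced_grading sL tens G i" "y \<in> induced_grading sL tens G j"
    for i j x y
    by (rule bilinear_span_into_subspace[OF bil k.subspace_single_0
          that(2,3)[unfolded induced_grading_def]])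
      (use m[OF that(1)] in \<open>auto simp: induced_form_tens[OF \<omega> form(1)]\<close>)
  then show ?thesis unfolding graded_form_def by (intro exI[of _ m]) simp
qed

text \<open>The bracket produces six terms \<open>\<omega>(a\<^sub>i \<circ> a\<^sub>j, a\<^sub>k) (b\<^sub>i \<diamond> b\<^sub>j, b\<^sub>k)\<close> up to sign.  Invariance reads
  \<open>(a \<diamond> b, c) = - (b \<diamond> c, a) - (c \<diamond> b, a)\<close>, whose right side is symmetric in \<open>b\<close> and \<open>c\<close>; so the six
  values on \<open>B\<close> coincide in pairs, which leaves three coefficients, and these sum to zero.
  The formula holds for every bilinear \<open>\<omega>\<close>, so it serves both directions of the equivalence.\<close>

lemma induced_form_cocycle_tens:
  assumes N: "novikov_algebra sA circ" and \<omega>: "bilinear_form sA \<omega>"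
    and "quadratic_graded_right_novikov_algebra sB dia G form"
  defines "F \<equiv> induced_form sL tens \<omega> form" and "br \<equiv> induced_bracket sL tens circ dia"
    and "C \<equiv> (\<lambda>a b c. \<omega> (circ a b) c - \<omega> (circ a c) b)"
  shows "F (br (tens a1 b1) (tens a2 b2)) (tens a3 b3) +
      F (br (tens a3 b3) (tens a1 b1)) (tens a2 b2) +
      F (br (tens a2 b2) (tens a3 b3)) (tens a1 b1) =
    form (dia b1 b2) b3 * C a1 a2 a3 + form (dia b2 b3) b1 * C a2 a3 a1
      + form (dia b3 b1) b2 * C a3 a1 a2" (is ?cocycle)
    and "form (dia b1 b2) b3 + form (dia b2 b3) b1 + form (dia b3 b1) b2 = 0" (is ?sum)
proof -
  interpret N: novikov_algebra sA circ by fact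
  interpret Q: quadratic_graded_right_novikov_algebra sB dia G form by fact
  note F = bilinear_map_simps(1-10)[OF induced_form_bilinear[OF \<omega> Q.form_bilinear], folded F_def]
  note Ft = induced_form_tens[OF \<omega> Q.form_bilinear, folded F_def]
  note brt = induced_bracket_tens[OF N.circ_bilinear Q.dia_bilinear, folded br_def]
  have inv: "form (dia a b) c = - form (dia b c) a - form (dia c b) a" for a b c
    using Q.form_invariant[of a b c] Q.form_symmetric bilinear_map_simps(2)[OF Q.form_bilinear]
    unfolding symmetric_form_def by (metis minus_add_distrib diff_conv_add_uminus)
  have sym: "form (dia a b) c = form (dia a c) b" for a b c
    using inv[of a b c] inv[of a c b] by simp
  show ?cocycle
    by (simp add: brt F Ft C_def sym[of b1 b3 b2] sym[of b2 b1 b3] sym[of b3 b2 b1] algebra_simps)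
  show ?sum
    using inv[of b1 b2 b3] sym[of b3 b1 b2] by simp
qed

lemma induced_form_quasi_frobenius:
  assumes "quasi_frobenius_novikov_algebra sA circ \<omega>"
    and Q: "quadratic_graded_right_novikov_algebra sB dia G form"
  defines "F \<equiv> induced_form sL tens \<omega> form" and "br \<equiv> induced_bracket sL tens circ dia"
  shows "F (br x y) z + F (br z x) y + F (br y z) x = 0"
proof -
  interpret W: quasi_frobenius_novikov_algebra sA circ \<omega> by fact
  interpret Q: quadratic_graded_right_novikov_algebra sB dia G form by fact
  note F = bilinear_map_simps(1-10)[OF induced_form_bilinear[OF W.form_bilinear Q.form_bilinear, folded F_def]]
  note br = bilinear_map_simps(1-10)[OF induced_bracket_bilinear[OF W.circ_bilinear
      Q.dia_bilinear], folded br_def]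
  have k: "vector_space ((*) :: 'k \<Rightarrow> 'k \<Rightarrow> 'k)" by (rule field_vector_space)
  show ?thesis
  proof (rule trilinear_zero_on_span[where s = sL and v = "(*)" and S = "{tens a b | a b. True}"
        and T = "\<lambda>x y z. F (br x y) z + F (br z x) y + F (br y z) x"])
    show "module.span sL {tens a b |a b. True} = UNIV" by (rule tens_span)
  next
    fix x y z assume "x \<in> {tens a b |a b. True}" "y \<in> {tens a b |a b. True}"
      "z \<in> {tens a b |a b. True}"
    then obtain a1 b1 a2 b2 a3 b3 where
      xyz: "x = tens a1 b1" "y = tens a2 b2" "z = tens a3 b3" by blast
    define C where "C a b c = \<omega> (circ a b) c - \<omega> (circ a c) b" for a b c
    \<comment> \<open>This is the quasi-Frobenius identity of \<open>A\<close>, rearranged.\<close>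
    have cyc: "C a b c = C c a b" for a b c
      using W.form_quasi_frobenius[of a b c]
      by (simp add: C_def bilinear_map_simps(1)[OF W.form_bilinear] algebra_simps)
    have "F (br x y) z + F (br z x) y + F (br y z) x =
      form (dia b1 b2) b3 * C a1 a2 a3 + form (dia b2 b3) b1 * C a2 a3 a1
      + form (dia b3 b1) b2 * C a3 a1 a2"
      unfolding xyz F_def br_def C_def
      by (rule induced_form_cocycle_tens(1)[OF W.novikov_algebra_axioms W.form_bilinear Q])
    also have "\<dots> = (form (dia b1 b2) b3 + form (dia b2 b3) b1 + form (dia b3 b1) b2) * C a1 a2 a3"
      using cyc[of a1 a2 a3] cyc[of a2 a3 a1] by (simp add: algebra_simps)
    also have "\<dots> = 0"
      using induced_form_cocycle_tens(2)[OF W.novikov_algebra_axioms W.form_bilinear Q] by simp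
    finally show "F (br x y) z + F (br z x) y + F (br y z) x = 0" .
  qed (use L.vector_space_axioms k in
      \<open>simp_all add: Vector_Spaces.linear_iff F br algebra_simps\<close>)
qed

lemma quasi_frobenius_graded_lie_algebra_tensor:
  assumes char0: "(2 :: 'k) \<noteq> 0" and fA: "finite_dimensional sA UNIV"
    and W: "quasi_frobenius_novikov_algebra sA circ \<omega>"
    and Q: "quadratic_graded_right_novikov_algebra sB dia G form"
  shows "quasi_frobenius_graded_lie_algebra sL (induced_grading sL tens G)
    (induced_bracket sL tens circ dia) (induced_form sL tens \<omega> form)"
proof -
  interpret W: quasi_frobenius_novikov_algebra sA circ \<omega> by fact
  interpret Q: quadratic_graded_right_novikov_algebra sB dia G form by fact
  interpret graded_lie_algebra sL "induced_grading sL tens G" "induced_bracket sL tens circ dia"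
    by (rule graded_lie_algebra_tensor[OF char0 fA W.novikov_algebra_axioms
          Q.right_novikov_algebra_axioms Q.graded_vector_space_axioms Q.dia_graded])
  show ?thesis
  proof
    let ?F = "induced_form sL tens \<omega> form" and ?br = "induced_bracket sL tens circ dia"
    show "bilinear_form sL ?F"
      by (rule induced_form_bilinear[OF W.form_bilinear Q.form_bilinear])
    show "skewsymmetric_form ?F"
      by (rule induced_form_skewsymmetric[OF W.form_bilinear W.form_skewsymmetric
            Q.form_bilinear Q.form_symmetric])
    show "nondegenerate_form ?F"
      by (rule induced_form_nondegenerate[OF fA W.form_bilinear W.form_skewsymmetric
            W.form_nondegenerate Q.form_bilinear Q.form_symmetric Q.form_nondegenerate])
    show "graded_form (induced_grading sL tens G) ?F"
      by (rule induced_form_graded[OF W.form_bilinear Q.form_bilinear Q.form_graded])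
    show "?F (?br x y) z + ?F (?br z x) y + ?F (?br y z) x = 0" for x y z
      by (rule induced_form_quasi_frobenius[OF W Q])
  qed
qed

end

section \<open>The Laurent polynomials\<close>

lemma free_linear_extension:
  assumes "vector_space s"
  shows "Vector_Spaces.linear free_scale s
    (\<lambda>f. \<Sum>i\<in>Poly_Mapping.keys f. s (Poly_Mapping.lookup f i) (H i))" (is "Vector_Spaces.linear _ _ ?h")
proof -
  interpret vector_space s by fact
  have sup: "?h f = (\<Sum>i\<in>S. s (Poly_Mapping.lookup f i) (H i))"
    if "finite S" "Poly_Mapping.keys f \<subseteq> S" for f S
    using that by (intro sum.mono_neutral_left) (auto simp: in_keys_iff)
  have "?h (f + g) = ?h f + ?h g" for f g
  proof -
    let ?S = "Poly_Mapping.keys f \<union> Poly_Mapping.keys g"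
    show ?thesis
      using sup[of ?S f] sup[of ?S g] sup[of ?S "f + g"] keys_add[of f g]
      by (simp add: lookup_add scale_left_distrib sum.distrib)
  qed
  moreover have "?h (free_scale c f) = s c (?h f)" for c f
  proof -
    have "Poly_Mapping.keys (free_scale c f) \<subseteq> Poly_Mapping.keys f"
      by (auto simp: in_keys_iff)
    then show ?thesis
      using sup[of "Poly_Mapping.keys f" "free_scale c f"] by (simp add: scale_sum_right)
  qed
  ultimately show ?thesis
    using assms free.vector_space_axioms unfolding Vector_Spaces.linear_iff by blast
qed

text \<open>The common source of the bilinearity of the Laurent product and of the Laurent form: each is
  the bilinear extension of its values \<open>H i j\<close> on pairs of monomials.\<close>

lemma free_bilinear_extension:
  assumes "vector_space s"
  shows "bilinear_map free_scale free_scale s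
    (\<lambda>f g. \<Sum>i\<in>Poly_Mapping.keys f. \<Sum>j\<in>Poly_Mapping.keys g.
      s (Poly_Mapping.lookup f i * Poly_Mapping.lookup g j) (H i j))" (is "bilinear_map _ _ _ ?h")
proof -
  interpret vector_space s by fact
  have 1: "?h f g = (\<Sum>i\<in>Poly_Mapping.keys f. s (Poly_Mapping.lookup f i)
      (\<Sum>j\<in>Poly_Mapping.keys g. s (Poly_Mapping.lookup g j) (H i j)))" for f g
    by (simp add: scale_sum_right)
  have 2: "?h f g = (\<Sum>j\<in>Poly_Mapping.keys g. s (Poly_Mapping.lookup g j)
      (\<Sum>i\<in>Poly_Mapping.keys f. s (Poly_Mapping.lookup f i) (H i j)))" for f g
    by (subst sum.swap) (simp add: scale_sum_right mult.commute)
  have "Vector_Spaces.linear free_scale s (\<lambda>f. ?h f g)" for g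
    unfolding 1 by (rule free_linear_extension[OF assms])
  moreover have "Vector_Spaces.linear free_scale s (\<lambda>g. ?h f g)" for f
    unfolding 2 by (rule free_linear_extension[OF assms])
  ultimately show ?thesis by (simp add: bilinear_map_def)
qed

lemma laurent_dia_bilinear: "bilinear_map free_scale free_scale free_scale laurent_dia"
  unfolding laurent_dia_def[abs_def]
  by (rule free_bilinear_extension[OF free.vector_space_axioms])

lemma laurent_form_bilinear: "bilinear_form free_scale laurent_form"
  unfolding laurent_form_def[abs_def]
  by (rule free_bilinear_extension[OF field_vector_space])

lemma single_eq_0_iff: "Poly_Mapping.single k v = 0 \<longleftrightarrow> v = 0"
  by (metis lookup_single_eq lookup_zero single_zero)

lemma free_expand:
  "f = (\<Sum>i\<in>Poly_Mapping.keys f. free_scale (Poly_Mapping.lookup f i) (Poly_Mapping.single i 1))"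
  by (rule poly_mapping_eqI)
    (auto simp: lookup_sum lookup_single when_def in_keys_iff if_distrib sum.delta cong: if_cong)

lemma span_monomials: "module.span free_scale (range laurent_monom) = UNIV"
proof -
  have "f \<in> free.span (range laurent_monom)" for f :: "int \<Rightarrow>\<^sub>0 'a"
    by (subst free_expand) (intro free.span_sum free.span_scale free.span_base, simp)
  then show ?thesis by blast
qed

text \<open>Pairing with monomials recovers all coefficients, which makes the form nondegenerate.\<close>

lemma laurent_form_monom_right: "laurent_form f (laurent_monom j) = Poly_Mapping.lookup f (- j - 1)"
proof -
  have "laurent_form f (laurent_monom j) =
      (\<Sum>i\<in>Poly_Mapping.keys f. if i = - j - 1 then Poly_Mapping.lookup f i else 0)"
    unfolding laurent_form_def by (intro sum.cong) auto
  then show ?thesis by (auto simp: sum.delta in_keys_iff)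
qed

lemma laurent_grading_eq: "laurent_grading i = range (\<lambda>c. Poly_Mapping.single (i + 1) c)"
proof -
  have "free_scale c (laurent_monom j) = Poly_Mapping.single j c" for c :: 'a and j
    by (rule poly_mapping_eqI) (simp add: lookup_single when_def)
  then show ?thesis by (simp add: laurent_grading_def free.span_singleton)
qed

lemma laurent_graded_vector_space:
  "graded_vector_space (free_scale :: 'k::field \<Rightarrow> _) laurent_grading"
proof
  fix i
  show "free.subspace (laurent_grading i)" by (simp add: laurent_grading_def)
  show "finite_dimensional free_scale (laurent_grading i)"
    unfolding finite_dimensional_def laurent_grading_def by blast
next
  fix x :: "int \<Rightarrow>\<^sub>0 'k"
  define f where "f i = Poly_Mapping.single (i + 1) (Poly_Mapping.lookup x (i + 1))" for i
  have f0: "f i \<noteq> 0 \<longleftrightarrow> i + 1 \<in> Poly_Mapping.keys x" for i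
    by (simp add: f_def in_keys_iff single_eq_0_iff)
  have "{i. f i \<noteq> 0} = (\<lambda>i. i - 1) ` Poly_Mapping.keys x"
    by (force simp: f0)
  then have fin: "finite {i. f i \<noteq> 0}" by simp
  show "\<exists>!f. (\<forall>i. f i \<in> laurent_grading i) \<and> finite {i. f i \<noteq> 0} \<and> x = (\<Sum>i | f i \<noteq> 0. f i)"
  proof (intro ex1I[of _ f] conjI allI fin)
    show "f i \<in> laurent_grading i" for i
      by (simp add: laurent_grading_eq f_def)
    show "x = (\<Sum>i | f i \<noteq> 0. f i)"
    proof (rule poly_mapping_eqI)
      fix j
      have "Poly_Mapping.lookup (\<Sum>i | f i \<noteq> 0. f i) j =
          (\<Sum>i | f i \<noteq> 0. if i = j - 1 then Poly_Mapping.lookup x j else 0)"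
        unfolding lookup_sum by (intro sum.cong) (auto simp: f_def lookup_single when_def)
      also have "\<dots> = Poly_Mapping.lookup x j"
        using fin by (auto simp: sum.delta f0 in_keys_iff)
      finally show "Poly_Mapping.lookup x j = Poly_Mapping.lookup (\<Sum>i | f i \<noteq> 0. f i) j" by simp
    qed
    fix g assume g: "(\<forall>i. g i \<in> laurent_grading i) \<and> finite {i. g i \<noteq> 0} \<and>
      x = (\<Sum>i | g i \<noteq> 0. g i)"
    then have "\<forall>i. \<exists>c. g i = Poly_Mapping.single (i + 1) c"
      unfolding laurent_grading_eq by blast
    then obtain c where c: "\<And>i. g i = Poly_Mapping.single (i + 1) (c i)"
      by metis
    have "Poly_Mapping.lookup x (j + 1) = c j" for j
    proof -
      have "Poly_Mapping.lookup x (j + 1) =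
          (\<Sum>i | g i \<noteq> 0. Poly_Mapping.lookup (g i) (j + 1))"
        using g lookup_sum[of g "{i. g i \<noteq> 0}" "j + 1"] by simp
      also have "\<dots> = (\<Sum>i | g i \<noteq> 0. if i = j then c j else 0)"
        by (intro sum.cong) (auto simp: c lookup_single when_def)
      also have "\<dots> = c j"
        using g by (auto simp: c single_eq_0_iff)
      finally show ?thesis .
    qed
    then show "g = f" by (auto simp: f_def c)
  qed
qed

text \<open>The product is \<open>f \<diamond> g = f' g\<close>.  Hence \<open>f \<diamond> (g \<diamond> h) = f' g' h\<close> is symmetric in \<open>f, g\<close>, and
  \<open>(f \<diamond> g) \<diamond> h - f \<diamond> (g \<diamond> h) = f'' g h\<close> is symmetric in \<open>g, h\<close>.  The form is the residue of \<open>f g\<close>,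
  and invariance says that the derivative \<open>(f g h)'\<close> has no residue.\<close>

lemma laurent_quadratic:
  "quadratic_graded_right_novikov_algebra (free_scale :: 'k::field \<Rightarrow> _)
     laurent_dia laurent_grading laurent_form"
proof -
  interpret G: graded_vector_space "free_scale :: 'k \<Rightarrow> _" laurent_grading
    by (rule laurent_graded_vector_space)
  note d = bilinear_map_simps(1-10)[OF laurent_dia_bilinear]
  note f = bilinear_map_simps(1-10)[OF laurent_form_bilinear]
  note lin = Vector_Spaces.linear_iff free.vector_space_axioms field_vector_space
    free.scale_right_diff_distrib
  note zero = trilinear_zero_on_span[where s = "free_scale :: 'k \<Rightarrow> (int \<Rightarrow>\<^sub>0 'k) \<Rightarrow> _",
      OF _ _ _ span_monomials]
  let ?m = "laurent_monom :: int \<Rightarrow> int \<Rightarrow>\<^sub>0 'k"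
  have sym: "laurent_form x y = laurent_form y x" for x y :: "int \<Rightarrow>\<^sub>0 'k"
    unfolding laurent_form_def by (subst sum.swap) (simp add: add.commute mult.commute)
  show ?thesis
  proof
    fix a b c x y :: "int \<Rightarrow>\<^sub>0 'k" and i j
    show "bilinear_map free_scale free_scale free_scale (laurent_dia :: (int \<Rightarrow>\<^sub>0 'k) \<Rightarrow> _)"
      by (rule laurent_dia_bilinear)
    show "bilinear_form free_scale (laurent_form :: (int \<Rightarrow>\<^sub>0 'k) \<Rightarrow> _)"
      by (rule laurent_form_bilinear)
    have "laurent_dia (laurent_dia a b) c - laurent_dia a (laurent_dia b c)
        - (laurent_dia (laurent_dia a c) b - laurent_dia a (laurent_dia c b)) = 0"
    proof (rule zero[where v = free_scale and T = "\<lambda>a b c.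
          laurent_dia (laurent_dia a b) c - laurent_dia a (laurent_dia b c)
        - (laurent_dia (laurent_dia a c) b - laurent_dia a (laurent_dia c b))"])
      fix a b c assume "a \<in> range ?m" "b \<in> range ?m" "c \<in> range ?m"
      then obtain i j k where "a = ?m i" "b = ?m j" "c = ?m k" by blast
      then show "laurent_dia (laurent_dia a b) c - laurent_dia a (laurent_dia b c)
        - (laurent_dia (laurent_dia a c) b - laurent_dia a (laurent_dia c b)) = 0"
        by (intro poly_mapping_eqI)
          (simp add: d laurent_dia_monom lookup_minus lookup_single when_def algebra_simps)
    qed (simp_all add: lin d)
    then show "laurent_dia (laurent_dia a b) c - laurent_dia a (laurent_dia b c) =
        laurent_dia (laurent_dia a c) b - laurent_dia a (laurent_dia c b)" by simp
    have "laurent_dia a (laurent_dia b c) - laurent_dia b (laurent_dia a c) = 0"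
    proof (rule zero[where v = free_scale and T = "\<lambda>a b c.
          laurent_dia a (laurent_dia b c) - laurent_dia b (laurent_dia a c)"])
      fix a b c assume "a \<in> range ?m" "b \<in> range ?m" "c \<in> range ?m"
      then obtain i j k where "a = ?m i" "b = ?m j" "c = ?m k" by blast
      then show "laurent_dia a (laurent_dia b c) - laurent_dia b (laurent_dia a c) = 0"
        by (intro poly_mapping_eqI)
          (simp add: d laurent_dia_monom lookup_minus lookup_single when_def algebra_simps)
    qed (simp_all add: lin d)
    then show "laurent_dia a (laurent_dia b c) = laurent_dia b (laurent_dia a c)" by simp
    have "laurent_form (laurent_dia a b) c + laurent_form a (laurent_dia b c + laurent_dia c b) = 0"
    proof (rule zero[where v = "(*)" and T = "\<lambda>a b c.
          laurent_form (laurent_dia a b) c + laurent_form a (laurent_dia b c + laurent_dia c b)"])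
      fix a b c assume "a \<in> range ?m" "b \<in> range ?m" "c \<in> range ?m"
      then obtain i j k where abc: "a = ?m i" "b = ?m j" "c = ?m k" by blast
      show "laurent_form (laurent_dia a b) c + laurent_form a (laurent_dia b c + laurent_dia c b) = 0"
      \<comment> \<open>The three values are \<open>i\<close>, \<open>j\<close>, \<open>k\<close> times the indicator of \<open>i + j + k = 0\<close>.\<close>
      proof (cases "k = - i - j")
        case True
        show ?thesis by (simp add: abc True d f laurent_dia_monom laurent_form_monom algebra_simps)
      next
        case False
        then show ?thesis by (simp add: abc d f laurent_dia_monom laurent_form_monom algebra_simps)
      qed
    qed (simp_all add: lin d f algebra_simps)
    then show "laurent_form (laurent_dia a b) c =
        - laurent_form a (laurent_dia b c + laurent_dia c b)"
      by (simp add: eq_neg_iff_add_eq_0)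
    show "symmetric_form (laurent_form :: (int \<Rightarrow>\<^sub>0 'k) \<Rightarrow> _)"
      unfolding symmetric_form_def using sym by blast
    have nd: "x = 0" if "\<And>y. laurent_form x y = 0" for x :: "int \<Rightarrow>\<^sub>0 'k"
    proof (rule poly_mapping_eqI)
      fix k
      show "Poly_Mapping.lookup x k = Poly_Mapping.lookup 0 k"
        using that[of "?m (- k - 1)"] by (simp add: laurent_form_monom_right)
    qed
    then show "nondegenerate_form (laurent_form :: (int \<Rightarrow>\<^sub>0 'k) \<Rightarrow> _)"
      unfolding nondegenerate_form_def using sym by metis
    have "laurent_form (Poly_Mapping.single k c) (Poly_Mapping.single l d :: int \<Rightarrow>\<^sub>0 'k) =
        (if k + l + 1 = 0 then c * d else 0)" for k l c d
      by (simp add: laurent_form_def)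
    \<comment> \<open>Degree \<open>i\<close> is spanned by \<open>t\<^bsup>i+1\<^esup>\<close>, so the condition \<open>(i + 1) + (j + 1) + 1 = 0\<close> gives shift 3.\<close>
    then show "graded_form laurent_grading (laurent_form :: (int \<Rightarrow>\<^sub>0 'k) \<Rightarrow> _)"
      unfolding graded_form_def laurent_grading_eq by (intro exI[of _ 3]) auto
    assume "x \<in> laurent_grading i" "y \<in> laurent_grading j"
    then show "laurent_dia x y \<in> laurent_grading (i + j)"
      unfolding laurent_grading_def
    proof (rule bilinear_span_into_subspace[OF laurent_dia_bilinear free.subspace_span])
      fix u v assume "u \<in> {?m (i + 1)}" "v \<in> {?m (j + 1)}"
      then have "laurent_dia u v = free_scale (of_int (i + 1)) (?m (i + 1 + (j + 1) - 1))"
        by (simp only: singleton_iff laurent_dia_monom)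
      also have "i + 1 + (j + 1) - 1 = i + j + 1" by simp
      finally show "laurent_dia u v \<in> free.span {?m (i + j + 1)}"
        by (simp only: free.span_scale free.span_base singletonI)
    qed
  qed
qed

section \<open>Recovering the Novikov algebra\<close>

text \<open>A functional \<open>c\<close> with \<open>c b = 1\<close> gives a left inverse \<open>id \<otimes> c\<close> of \<open>a \<mapsto> a \<otimes> b\<close>.\<close>

lemma (in tensor_product) tens_inject:
  assumes c: "Vector_Spaces.linear sB (*) c" "c b = 1"
    and "tens a b = tens a' b"
  shows "a = a'"
proof -
  have "bilinear_map sA sB sA (\<lambda>a b. sA (c b) a)"
    using c(1) A.vector_space_axioms
    by (simp add: bilinear_map_iff Vector_Spaces.linear_iff A.scale_right_distrib
        A.scale_left_distrib mult.commute)
  from tensor_universal[OF this] obtain g where "\<And>a b. g (tens a b) = sA (c b) a" by blast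
  then have "g (tens a b) = a" "g (tens a' b) = a'" using c(2) by simp_all
  then show ?thesis using assms(3) by metis
qed

text \<open>Since \<open>(1, t\<^sup>-\<^sup>1) = 1\<close>, skewsymmetry and nondegeneracy of \<open>\<omega>\<close> are read off from the tensors
  \<open>a \<otimes> 1\<close> and \<open>b \<otimes> t\<^sup>-\<^sup>1\<close>: a radical element \<open>a\<close> of \<open>\<omega>\<close> yields the radical element \<open>a \<otimes> 1\<close>.  The
  quasi-Frobenius identity is the cocycle identity at \<open>a \<otimes> t\<close>, \<open>b \<otimes> 1\<close>, \<open>c \<otimes> t\<^sup>-\<^sup>1\<close>.\<close>

lemma quasi_frobenius_novikov_of_laurent:
  fixes sA :: "'k::field \<Rightarrow> 'a::ab_group_add \<Rightarrow> 'a"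
  assumes T: "tensor_product sA free_scale sM tensM" and N: "novikov_algebra sA circ"
    and \<omega>: "bilinear_form sA \<omega>"
    and "quasi_frobenius_graded_lie_algebra sM (induced_grading sM tensM laurent_grading)
      (induced_bracket sM tensM circ laurent_dia) (induced_form sM tensM \<omega> laurent_form)"
  shows "quasi_frobenius_novikov_algebra sA circ \<omega>"
proof -
  interpret tensor_product sA free_scale sM tensM by fact
  interpret N: novikov_algebra sA circ by fact
  interpret k: vector_space "(*) :: 'k \<Rightarrow> 'k \<Rightarrow> 'k" by (rule field_vector_space)
  let ?F = "induced_form sM tensM \<omega> laurent_form"
    and ?br = "induced_bracket sM tensM circ laurent_dia"
  interpret M: quasi_frobenius_graded_lie_algebra sM "induced_grading sM tensM laurent_grading"
    ?br ?F by fact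
  note Ft = induced_form_tens[OF \<omega> laurent_form_bilinear]
  note Q = laurent_quadratic
  note w = bilinear_map_simps[OF \<omega>]
  have skew: "\<omega> a b = - \<omega> b a" for a b
  proof -
    have "?F (tensM a (laurent_monom 0)) (tensM b (laurent_monom (- 1))) =
      - ?F (tensM b (laurent_monom (- 1))) (tensM a (laurent_monom 0))"
      using M.form_skewsymmetric unfolding skewsymmetric_form_def by blast
    then show ?thesis by (simp only: Ft laurent_form_monom) simp
  qed
  have nd: "a = 0" if a: "\<And>b. \<omega> a b = 0" for a
  proof -
    have "?F (tensM a (laurent_monom 0)) y \<in> {0}" for y
      by (rule linear_span_into_subspace[OF _ k.subspace_single_0 in_tens_span])
        (use M.form_bilinear a in \<open>auto simp: bilinear_map_def Ft\<close>)
    then have "tensM a (laurent_monom 0) = 0"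
      using M.form_nondegenerate unfolding nondegenerate_form_def by blast
    then have "tensM a (laurent_monom 0) = tensM 0 (laurent_monom 0)"
      by (simp add: tens_simps)
    then show "a = 0"
      by (rule tens_inject[where c = "\<lambda>f. Poly_Mapping.lookup f 0", rotated 2])
        (auto simp: Vector_Spaces.linear_iff field_vector_space free.vector_space_axioms lookup_add)
  qed
  show ?thesis
  proof
    show "bilinear_form sA \<omega>" by fact
    show "skewsymmetric_form \<omega>" unfolding skewsymmetric_form_def using skew by blast
    show "nondegenerate_form \<omega>"
      unfolding nondegenerate_form_def using nd skew by (metis neg_equal_0_iff_equal)
    fix a b c
    let ?x = "tensM a (laurent_monom 1)" and ?y = "tensM b (laurent_monom 0)"
      and ?z = "tensM c (laurent_monom (- 1))"
    have "?F (?br ?x ?y) ?z + ?F (?br ?z ?x) ?y + ?F (?br ?y ?z) ?x = 0"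
      by (rule M.form_quasi_frobenius)
    then show "\<omega> (circ a b) c - \<omega> (circ a c + circ c a) b + \<omega> (circ c b) a = 0"
      unfolding induced_form_cocycle_tens(1)[OF N \<omega> Q]
      by (simp only: laurent_dia_monom laurent_form_monom
          bilinear_map_simps(3)[OF laurent_form_bilinear]) (simp add: w algebra_simps)
  qed
qed

theorem proposition4p9:
  fixes sA :: "'k::field_char_0 \<Rightarrow> 'a::ab_group_add \<Rightarrow> 'a"
    and circ :: "'a \<Rightarrow> 'a \<Rightarrow> 'a"
    and \<omega> :: "'a \<Rightarrow> 'a \<Rightarrow> 'k"
    and sB :: "'k \<Rightarrow> 'b::ab_group_add \<Rightarrow> 'b"
    and dia :: "'b \<Rightarrow> 'b \<Rightarrow> 'b"
    and G :: "int \<Rightarrow> 'b set"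
    and form :: "'b \<Rightarrow> 'b \<Rightarrow> 'k"
    and sL :: "'k \<Rightarrow> 'l::ab_group_add \<Rightarrow> 'l"
    and tens :: "'a \<Rightarrow> 'b \<Rightarrow> 'l"
    and sM :: "'k \<Rightarrow> 'm::ab_group_add \<Rightarrow> 'm"
    and tensM :: "'a \<Rightarrow> (int \<Rightarrow>\<^sub>0 'k) \<Rightarrow> 'm"
  assumes A_novikov: "novikov_algebra sA circ"
    and A_finite_dimensional: "finite_dimensional sA UNIV"
    and \<omega>_bilinear: "bilinear_form sA \<omega>"
  shows
    "(quadratic_graded_right_novikov_algebra sB dia G form \<and> tensor_product sA sB sL tens \<and>
      quasi_frobenius_novikov_algebra sA circ \<omega> \<longrightarrow>
        quasi_frobenius_graded_lie_algebra sL (induced_grading sL tens G)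
          (induced_bracket sL tens circ dia) (induced_form sL tens \<omega> form)) \<and>
     (tensor_product sA free_scale sM tensM \<longrightarrow>
       (quasi_frobenius_graded_lie_algebra sM (induced_grading sM tensM laurent_grading)
          (induced_bracket sM tensM circ laurent_dia) (induced_form sM tensM \<omega> laurent_form)
        \<longleftrightarrow> quasi_frobenius_novikov_algebra sA circ \<omega>))"
proof (intro conjI impI)
  assume "quadratic_graded_right_novikov_algebra sB dia G form \<and> tensor_product sA sB sL tens \<and>
    quasi_frobenius_novikov_algebra sA circ \<omega>"
  then show "quasi_frobenius_graded_lie_algebra sL (induced_grading sL tens G)
      (induced_bracket sL tens circ dia) (induced_form sL tens \<omega> form)"
    using A_finite_dimensional
    by (intro tensor_product.quasi_frobenius_graded_lie_algebra_tensor) auto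
next
  assume T: "tensor_product sA free_scale sM tensM"
  show "quasi_frobenius_graded_lie_algebra sM (induced_grading sM tensM laurent_grading)
      (induced_bracket sM tensM circ laurent_dia) (induced_form sM tensM \<omega> laurent_form)
    \<longleftrightarrow> quasi_frobenius_novikov_algebra sA circ \<omega>"
    using quasi_frobenius_novikov_of_laurent[OF T A_novikov \<omega>_bilinear]
      tensor_product.quasi_frobenius_graded_lie_algebra_tensor[OF T _ A_finite_dimensional _
        laurent_quadratic]
    by auto
qed

end
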